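(* Let $T<\infty$ be a fixed time horizon and assume: (A1) for all $0\le t\le T$, $g_t(x)>0$ for every $x\in\mathbb X$, and $\sup_{0\le t\le T}|g_t|_\infty<\infty$; (A2) $\sup_{1\le t\le T}|\vartheta_t|_\infty<\infty$ and $\sup_{0\le t\le T}|\omega_t|_\infty<\infty$. Then there exist constants $0<B<\infty$ and $0<C<\infty$ (depending on $T$) such that for all $N\ge1$, all $\epsilon>0$, and all $h\in\mathcal F_b(\mathbb X^{T+1})$, $$\mathbb P\big[\,|\tilde\phi^N_{0:T|T}(h)-\phi_{0:T|T}(h)|\ge\epsilon\,\big]\le B\,e^{-CN\epsilon^2/\operatorname{osc}^2(h)} ,$$ where $\tilde\phi^N_{0:T|T}$ is the forward filtering backward simulation (FFBSi) estimator.
   Context: Model. $(\mathbb X,\mathcal B(\mathbb X))$ and $(\mathbb Y,\mathcal B(\mathbb Y))$ are Polish spaces with their Borel $\sigma$-algebras; $\mathcal F_b(\mathbb X^d)$ is the set of bounded measurable real functions on $\mathbb X^d$; $|f|_\infty$ is the supremum norm, $\operatorname{osc}(f)=\sup_{x,x'}|f(x)-f(x')|$, $\operatorname{osc}^2(f)=(\operatorname{osc}(f))^2$, and $x_{m:n}=(x_m,\dots,x_n)$. $\chi$ is a probability measure on $\mathbb X$ (initial law), $M$ is a Markov kernel on $\mathbb X$ with transition density $m$ with respect to a $\sigma$-finite measure $\nu$: $M(x,dx')=m(x,x')\,dx'$, where $dx'$ stands for $\nu(dx')$. $g:\mathbb X\times\mathbb Y\to[0,\infty)$ is the likelihood (density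 of an observation given the state). The observations $y_0,\dots,y_T$ are fixed and $g_t(x)=g(x,y_t)$. The joint smoothing distribution is $$\phi_{0:T|T}(h)=\frac{\int\cdots\int\chi(dx_0)\prod_{u=1}^T g_{u-1}(x_{u-1})M(x_{u-1},dx_u)\,g_T(x_T)\,h(x_{0:T})}{\int\cdots\int\chi(dx_0)\prod_{u=1}^T g_{u-1}(x_{u-1})M(x_{u-1},dx_u)\,g_T(x_T)},\quad h\in\mathcal F_b(\mathbb X^{T+1}),$$ the denominator being assumed positive. Particle filter. $\rho_0$ is a probability measure on $\mathbb X$ with $\chi\ll\rho_0$; for $t\ge1$, $\vartheta_t:\mathbb X\to(0,\infty)$ is measurable, and $P_t$ is a Markov kernel with density $p_t$ with respect to $\nu$, with $p_t(x,x')>0$ whenever $m(x,x')g_t(x')>0$. Weight functions: $\omega_0(x)=\frac{d\chi}{d\rho_0}(x)g_0(x)$ and $\omega_t(x,x')=\frac{m(x,x')g_t(x')}{\vartheta_t(x)p_t(x,x')}$, $t\ge1$. For each $N\ge1$: $\xi_0^1,\dots,\xi_0^N$ are i.i.d. with law $\rho_0$ and $\omega_0^i=\omega_0(\xi_0^i)$; for $t\ge1$, conditionally on all particles and weights up to time $t-1$, the pairs $(I_t^i,\xi_t^i)$, $i=1,\dots,N$, are i.i.d. on $\{1,\dots,N\}\times\mathbb X$ with law proportional to $(j,dx)\mapsto\omega_{t-1}^j\vartheta_t(\xi_{t-1}^j)P_t(\xi_{t-1}^j,dx)$, and $\omega_t^i=\omega_t(\xi_{t-1}^{I_t^i},\xi_t^i)$.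 Put $\Omega_t=\sum_{i=1}^N\omega_t^i$. FFBSi estimator. Let $\mathcal F_T^N$ be the $\sigma$-field generated by all particles and weights up to time $T$ (and the observations). Conditionally on $\mathcal F_T^N$, the index paths $J^\ell_{0:T}=(J_0^\ell,\dots,J_T^\ell)$, $\ell=1,\dots,N$, are i.i.d. with: $J_T^\ell=i$ with probability $\omega_T^i/\Omega_T$; and, backward in time, given $J_{t+1}^\ell=i$, $J_t^\ell=j$ with probability $\Lambda_t^N(i,j)=\frac{\omega_t^jm(\xi_t^j,\xi_{t+1}^i)}{\sum_{k=1}^N\omega_t^km(\xi_t^k,\xi_{t+1}^i)}$, $0\le t\le T-1$. The estimator is $\tilde\phi^N_{0:T|T}(h)=N^{-1}\sum_{\ell=1}^Nh(\xi_0^{J_0^\ell},\dots,\xi_T^{J_T^\ell})$. *)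

theory Defs
  imports "HOL-Probability.Probability"
begin

text \<open>
  Points of $X^{T+1}$ are represented as functions on \<open>{..T}\<close>, extended by \<open>undefined\<close>,
  i.e. as elements of the space of \<open>Pi\<^sub>M {..T} (\<lambda>_. borel)\<close>.
\<close>

definition bounded_measurable :: "nat \<Rightarrow> ((nat \<Rightarrow> 'x::topological_space) \<Rightarrow> real) set" where
  "bounded_measurable T =
    {h \<in> borel_measurable (Pi\<^sub>M {..T} (\<lambda>_. borel)). bounded (h ` space (Pi\<^sub>M {..T} (\<lambda>_. borel :: 'x measure)))}"

definition osc :: "nat \<Rightarrow> ((nat \<Rightarrow> 'x::topological_space) \<Rightarrow> real) \<Rightarrow> real" where
  "osc T h = (let S = space (Pi\<^sub>M {..T} (\<lambda>_. borel :: 'x measure)) in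
     SUP (x, x') \<in> S \<times> S. \<bar>h x - h x'\<bar>)"

definition sup_norm :: "('a \<Rightarrow> real) \<Rightarrow> ennreal" where
  "sup_norm f = (SUP x. ennreal \<bar>f x\<bar>)"

definition lik :: "('x \<Rightarrow> 'y \<Rightarrow> real) \<Rightarrow> (nat \<Rightarrow> 'y) \<Rightarrow> nat \<Rightarrow> 'x \<Rightarrow> real" where
  "lik g y t x = g x (y t)"

text \<open>
  \<open>joint_integral_from M G h t k x\<close> integrates out the coordinates \<open>t + 1, \<dots>, t + k\<close>, given the
  coordinates of \<open>x\<close> up to time \<open>t\<close>; the likelihood factors are those of the times \<open>t, \<dots>, t + k\<close>.
\<close>

primrec joint_integral_from ::
    "('x \<Rightarrow> 'x measure) \<Rightarrow> (nat \<Rightarrow> 'x \<Rightarrow> real) \<Rightarrow> ((nat \<Rightarrow> 'x) \<Rightarrow> real) \<Rightarrow> nat \<Rightarrow> nat \<Rightarrow> (nat \<Rightarrow> 'x) \<Rightarrow> real"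
  where
    "joint_integral_from M G h t 0 x = G t (x t) * h x"
  | "joint_integral_from M G h t (Suc k) x =
       (\<integral>x'. G t (x t) * joint_integral_from M G h (Suc t) k (x(Suc t := x')) \<partial>M (x t))"

definition joint_integral ::
    "'x measure \<Rightarrow> ('x \<Rightarrow> 'x measure) \<Rightarrow> (nat \<Rightarrow> 'x \<Rightarrow> real) \<Rightarrow> nat \<Rightarrow> ((nat \<Rightarrow> 'x) \<Rightarrow> real) \<Rightarrow> real" where
  "joint_integral \<chi>0 M G T h =
     (\<integral>x. joint_integral_from M G h 0 T ((\<lambda>_. undefined)(0 := x)) \<partial>\<chi>0)"

definition smoothing ::
    "'x measure \<Rightarrow> ('x \<Rightarrow> 'x measure) \<Rightarrow> (nat \<Rightarrow> 'x \<Rightarrow> real) \<Rightarrow> nat \<Rightarrow> ((nat \<Rightarrow> 'x) \<Rightarrow> real) \<Rightarrow> real" where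
  "smoothing \<chi>0 M G T h = joint_integral \<chi>0 M G T h / joint_integral \<chi>0 M G T (\<lambda>_. 1)"

text \<open>
  \<open>r0\<close> is an arbitrary real-valued version of the Radon--Nikodym derivative of \<open>\<chi>0\<close> with respect to
  \<open>\<rho>0\<close>; assumption \<open>r0_density\<close> entails that \<open>\<chi>0\<close> is absolutely continuous with respect to \<open>\<rho>0\<close>.
\<close>

locale smc_model =
  fixes \<chi>0 \<nu> :: "'x::polish_space measure"
    and M :: "'x \<Rightarrow> 'x measure" and m :: "'x \<Rightarrow> 'x \<Rightarrow> real"
    and g :: "'x \<Rightarrow> 'y::polish_space \<Rightarrow> real" and y :: "nat \<Rightarrow> 'y" and T :: nat
    and \<rho>0 :: "'x measure" and r0 :: "'x \<Rightarrow> real"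
    and \<theta> :: "nat \<Rightarrow> 'x \<Rightarrow> real"
    and P :: "nat \<Rightarrow> 'x \<Rightarrow> 'x measure" and p :: "nat \<Rightarrow> 'x \<Rightarrow> 'x \<Rightarrow> real"
  assumes init_prob: "prob_space \<chi>0" "sets \<chi>0 = sets borel"
    and ref_sigma_finite: "sigma_finite_measure \<nu>" "sets \<nu> = sets borel"
    and M_kernel: "M \<in> borel \<rightarrow>\<^sub>M prob_algebra borel"
    and m_meas: "(\<lambda>(x, x'). m x x') \<in> borel_measurable (borel \<Otimes>\<^sub>M borel)"
    and m_nonneg: "\<And>x x'. 0 \<le> m x x'"
    and M_density: "\<And>x. M x = density \<nu> (\<lambda>x'. ennreal (m x x'))"
    and g_meas: "(\<lambda>(x, z). g x z) \<in> borel_measurable (borel \<Otimes>\<^sub>M borel)"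
    and g_nonneg: "\<And>x z. 0 \<le> g x z"
    and normalizer_pos: "0 < joint_integral \<chi>0 M (lik g y) T (\<lambda>_. 1)"
    and proposal_init: "prob_space \<rho>0" "sets \<rho>0 = sets borel"
    and r0_meas: "r0 \<in> borel_measurable borel"
    and r0_nonneg: "\<And>x. 0 \<le> r0 x"
    and r0_density: "\<chi>0 = density \<rho>0 (\<lambda>x. ennreal (r0 x))"
    and \<theta>_meas: "\<And>t. t \<in> {1..T} \<Longrightarrow> \<theta> t \<in> borel_measurable borel"
    and \<theta>_pos: "\<And>t x. t \<in> {1..T} \<Longrightarrow> 0 < \<theta> t x"
    and P_kernel: "\<And>t. t \<in> {1..T} \<Longrightarrow> P t \<in> borel \<rightarrow>\<^sub>M prob_algebra borel"
    and p_meas: "\<And>t. t \<in> {1..T} \<Longrightarrow> (\<lambda>(x, x'). p t x x') \<in> borel_measurable (borel \<Otimes>\<^sub>M borel)"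
    and p_nonneg: "\<And>t x x'. t \<in> {1..T} \<Longrightarrow> 0 \<le> p t x x'"
    and P_density: "\<And>t x. t \<in> {1..T} \<Longrightarrow> P t x = density \<nu> (\<lambda>x'. ennreal (p t x x'))"
    and p_pos: "\<And>t x x'. t \<in> {1..T} \<Longrightarrow> 0 < m x x' * lik g y t x' \<Longrightarrow> 0 < p t x x'"

definition weight_init :: "('x \<Rightarrow> real) \<Rightarrow> (nat \<Rightarrow> 'x \<Rightarrow> real) \<Rightarrow> 'x \<Rightarrow> real" where
  "weight_init r0 G x = r0 x * G 0 x"

text \<open>If \<open>p t x x' = 0\<close>, the numerator vanishes as well and the weight is \<open>0\<close>.\<close>

definition weight_step ::
    "('x \<Rightarrow> 'x \<Rightarrow> real) \<Rightarrow> (nat \<Rightarrow> 'x \<Rightarrow> real) \<Rightarrow> (nat \<Rightarrow> 'x \<Rightarrow> real) \<Rightarrow> (nat \<Rightarrow> 'x \<Rightarrow> 'x \<Rightarrow> real)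
      \<Rightarrow> nat \<Rightarrow> 'x \<Rightarrow> 'x \<Rightarrow> real" where
  "weight_step m G \<theta> p t x x' = m x x' * G t x' / (\<theta> t x * p t x x')"

text \<open>
  Random variables on a sample space \<open>'w\<close>: \<open>\<xi> t i\<close> is the \<open>i\<close>-th particle at time \<open>t\<close>, \<open>I t i\<close> the index
  of its ancestor at time \<open>t - 1\<close>, and \<open>J l t\<close> the time-\<open>t\<close> index of the \<open>l\<close>-th backward path.
\<close>

definition particle_weight ::
    "('x \<Rightarrow> real) \<Rightarrow> (nat \<Rightarrow> 'x \<Rightarrow> 'x \<Rightarrow> real) \<Rightarrow> (nat \<Rightarrow> nat \<Rightarrow> 'w \<Rightarrow> 'x) \<Rightarrow> (nat \<Rightarrow> nat \<Rightarrow> 'w \<Rightarrow> nat)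
      \<Rightarrow> nat \<Rightarrow> nat \<Rightarrow> 'w \<Rightarrow> real" where
  "particle_weight \<omega>0 \<omega> \<xi> I t i w =
     (if t = 0 then \<omega>0 (\<xi> 0 i w) else \<omega> t (\<xi> (t - 1) (I t i w) w) (\<xi> t i w))"

text \<open>The sigma-field generated by all particles and weights up to time \<open>t\<close>.\<close>

definition particle_field ::
    "'w measure \<Rightarrow> nat \<Rightarrow> (nat \<Rightarrow> nat \<Rightarrow> 'w \<Rightarrow> 'x::topological_space) \<Rightarrow> (nat \<Rightarrow> nat \<Rightarrow> 'w \<Rightarrow> real)
      \<Rightarrow> nat \<Rightarrow> 'w measure" where
  "particle_field Pr N \<xi> W t =
     vimage_algebra (space Pr) (\<lambda>w. \<lambda>(s, i)\<in>{..t} \<times> {1..N}. (\<xi> s i w, W s i w))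
       (Pi\<^sub>M ({..t} \<times> {1..N}) (\<lambda>_. borel \<Otimes>\<^sub>M borel))"

text \<open>
  On the event \<open>E\<close>, the variables \<open>X i\<close> (\<open>i \<in> K\<close>, with values in \<open>S\<close>) are conditionally i.i.d. given
  the sigma-field \<open>F\<close>, with conditional law \<open>\<kappa> w\<close>, given as a function of measurable sets.
\<close>

definition cond_iid_on ::
    "'w measure \<Rightarrow> 'w measure \<Rightarrow> 'w set \<Rightarrow> 'i set \<Rightarrow> 'b measure \<Rightarrow> ('i \<Rightarrow> 'w \<Rightarrow> 'b) \<Rightarrow> ('w \<Rightarrow> 'b set \<Rightarrow> real) \<Rightarrow> bool"
  where
  "cond_iid_on Pr F E K S X \<kappa> \<longleftrightarrow>
     (\<forall>i\<in>K. X i \<in> Pr \<rightarrow>\<^sub>M S) \<and>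
     (\<forall>A. (\<forall>i\<in>K. A i \<in> sets S) \<longrightarrow>
        (AE w in Pr. w \<in> E \<longrightarrow>
           real_cond_exp Pr F (indicator {v \<in> space Pr. \<forall>i\<in>K. X i v \<in> A i}) w = (\<Prod>i\<in>K. \<kappa> w (A i))))"

text \<open>
  The normalised weights are undefined when all weights of one generation vanish, an event which
  may have positive probability. The conditional laws are therefore prescribed only on the event that
  this has not happened so far; nothing is assumed about how the algorithm continues otherwise
  (except that indices take values in \<open>{1..N}\<close>).
\<close>

definition alive :: "'w measure \<Rightarrow> nat \<Rightarrow> (nat \<Rightarrow> nat \<Rightarrow> 'w \<Rightarrow> real) \<Rightarrow> nat \<Rightarrow> 'w set" where
  "alive Pr N W t = {w \<in> space Pr. \<forall>s\<le>t. 0 < (\<Sum>i=1..N. W s i w)}"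

definition selection_mutation_law ::
    "nat \<Rightarrow> (nat \<Rightarrow> 'x \<Rightarrow> real) \<Rightarrow> (nat \<Rightarrow> 'x \<Rightarrow> 'x measure) \<Rightarrow> (nat \<Rightarrow> nat \<Rightarrow> 'w \<Rightarrow> 'x) \<Rightarrow> (nat \<Rightarrow> nat \<Rightarrow> 'w \<Rightarrow> real)
      \<Rightarrow> nat \<Rightarrow> 'w \<Rightarrow> (nat \<times> 'x) set \<Rightarrow> real" where
  "selection_mutation_law N \<theta> P \<xi> W t w A =
     (\<Sum>j=1..N. W (t - 1) j w * \<theta> t (\<xi> (t - 1) j w) * measure (P t (\<xi> (t - 1) j w)) {x. (j, x) \<in> A}) /
     (\<Sum>j=1..N. W (t - 1) j w * \<theta> t (\<xi> (t - 1) j w))"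

definition backward_kernel ::
    "nat \<Rightarrow> ('x \<Rightarrow> 'x \<Rightarrow> real) \<Rightarrow> (nat \<Rightarrow> nat \<Rightarrow> 'w \<Rightarrow> 'x) \<Rightarrow> (nat \<Rightarrow> nat \<Rightarrow> 'w \<Rightarrow> real)
      \<Rightarrow> nat \<Rightarrow> 'w \<Rightarrow> nat \<Rightarrow> nat \<Rightarrow> real" where
  "backward_kernel N m \<xi> W t w i j =
     W t j w * m (\<xi> t j w) (\<xi> (Suc t) i w) / (\<Sum>k=1..N. W t k w * m (\<xi> t k w) (\<xi> (Suc t) i w))"

text \<open>Law of the backward Markov chain of indices, as a measure on the finite set of index paths.\<close>

definition backward_path_law ::
    "nat \<Rightarrow> nat \<Rightarrow> ('x \<Rightarrow> 'x \<Rightarrow> real) \<Rightarrow> (nat \<Rightarrow> nat \<Rightarrow> 'w \<Rightarrow> 'x) \<Rightarrow> (nat \<Rightarrow> nat \<Rightarrow> 'w \<Rightarrow> real)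
      \<Rightarrow> 'w \<Rightarrow> (nat \<Rightarrow> nat) set \<Rightarrow> real" where
  "backward_path_law N T m \<xi> W w A =
     (\<Sum>j\<in>A. W T (j T) w / (\<Sum>i=1..N. W T i w) * (\<Prod>t<T. backward_kernel N m \<xi> W t w (j (Suc t)) (j t)))"

locale particle_filter = prob_space Pr
  for Pr :: "'w measure" +
  fixes N T :: nat
    and \<rho>0 :: "'x::polish_space measure"
    and \<theta> :: "nat \<Rightarrow> 'x \<Rightarrow> real" and P :: "nat \<Rightarrow> 'x \<Rightarrow> 'x measure"
    and \<omega>0 :: "'x \<Rightarrow> real" and \<omega> :: "nat \<Rightarrow> 'x \<Rightarrow> 'x \<Rightarrow> real"
    and \<xi> :: "nat \<Rightarrow> nat \<Rightarrow> 'w \<Rightarrow> 'x" and I :: "nat \<Rightarrow> nat \<Rightarrow> 'w \<Rightarrow> nat"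
  assumes initial_indep: "indep_vars (\<lambda>_. borel) (\<xi> 0) {1..N}"
    and initial_law: "\<And>i. i \<in> {1..N} \<Longrightarrow> distr Pr borel (\<xi> 0 i) = \<rho>0"
    and selection_mutation: "\<And>t. t \<in> {1..T} \<Longrightarrow>
      cond_iid_on Pr (particle_field Pr N \<xi> (particle_weight \<omega>0 \<omega> \<xi> I) (t - 1))
        (alive Pr N (particle_weight \<omega>0 \<omega> \<xi> I) (t - 1))
        {1..N} (count_space {1..N} \<Otimes>\<^sub>M borel) (\<lambda>i w. (I t i w, \<xi> t i w))
        (selection_mutation_law N \<theta> P \<xi> (particle_weight \<omega>0 \<omega> \<xi> I) t)"

locale ffbsi = particle_filter Pr N T \<rho>0 \<theta> P \<omega>0 \<omega> \<xi> I
  for Pr :: "'w measure" and N T :: nat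
    and \<rho>0 :: "'x::polish_space measure"
    and \<theta> :: "nat \<Rightarrow> 'x \<Rightarrow> real" and P :: "nat \<Rightarrow> 'x \<Rightarrow> 'x measure"
    and \<omega>0 :: "'x \<Rightarrow> real" and \<omega> :: "nat \<Rightarrow> 'x \<Rightarrow> 'x \<Rightarrow> real"
    and \<xi> :: "nat \<Rightarrow> nat \<Rightarrow> 'w \<Rightarrow> 'x" and I :: "nat \<Rightarrow> nat \<Rightarrow> 'w \<Rightarrow> nat" +
  fixes m :: "'x \<Rightarrow> 'x \<Rightarrow> real" and J :: "nat \<Rightarrow> nat \<Rightarrow> 'w \<Rightarrow> nat"
  assumes backward_simulation:
    "cond_iid_on Pr (particle_field Pr N \<xi> (particle_weight \<omega>0 \<omega> \<xi> I) T)
       (alive Pr N (particle_weight \<omega>0 \<omega> \<xi> I) T)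
       {1..N} (count_space ({..T} \<rightarrow>\<^sub>E {1..N})) (\<lambda>l w. \<lambda>t\<in>{..T}. J l t w)
       (backward_path_law N T m \<xi> (particle_weight \<omega>0 \<omega> \<xi> I))"

definition ffbsi_estimator ::
    "nat \<Rightarrow> nat \<Rightarrow> (nat \<Rightarrow> nat \<Rightarrow> 'w \<Rightarrow> 'x) \<Rightarrow> (nat \<Rightarrow> nat \<Rightarrow> 'w \<Rightarrow> nat) \<Rightarrow> ((nat \<Rightarrow> 'x) \<Rightarrow> real) \<Rightarrow> 'w \<Rightarrow> real" where
  "ffbsi_estimator N T \<xi> J h w = (\<Sum>l=1..N. h (\<lambda>t\<in>{..T}. \<xi> t (J l t w) w)) / real N"

text \<open>
  The bound $B \exp(- C N \epsilon^2 / \mathrm{osc}^2(h))$, read as $0$ (exponent $-\infty$) when \<open>osc T h = 0\<close>;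
  division by zero in HOL would give the trivial bound \<open>B\<close> instead.
\<close>

definition deviation_bound ::
    "real \<Rightarrow> real \<Rightarrow> nat \<Rightarrow> real \<Rightarrow> nat \<Rightarrow> ((nat \<Rightarrow> 'x::topological_space) \<Rightarrow> real) \<Rightarrow> real" where
  "deviation_bound B C N \<epsilon> T h =
     (if osc T h = 0 then 0 else B * exp (- (C * real N * \<epsilon>\<^sup>2 / (osc T h)\<^sup>2)))"

end

theory Submission
  imports Defs
begin

text \<open>
  Put $S_t(h) = N^{-1} \sum_j \omega_t^{j_t} \prod_{s<t} \Lambda_s(j_{s+1}, j_s)\, h(\xi^{j})$, the sum running over
  index paths, and $L_t h(x_{0:t}) = \int g_{t+1}(x') h(x_{0:t}, x') M(x_t, dx')$. The denominator of the backward
  kernel cancels against the proposal, so that, given the particles up to time $t$, $S_{t+1}(h)$ is an average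
  of i.i.d. bounded terms with mean $S_t(L_t h) / D_t$, where $D_t$ does not depend on $h$. Hoeffding's inequality, applied
  conditionally to $h$ and to $1$, reduces the deviation of $S_{t+1}(h) / S_{t+1}(1)$ to those of
  $S_t(L_t h) / S_t(1)$ and $S_t(L_t 1) / S_t(1)$, whence an exponential bound by induction on $t$; the bound
  includes the probability that all weights vanish. Given the particles, the FFBSi estimator is itself an
  average of i.i.d. terms with mean $S_T(h) / S_T(1)$.
\<close>

section \<open>Hoeffding's inequality for conditionally i.i.d. variables\<close>

text \<open>A path sum at time \<open>t\<close> has N^(t+1) terms that are far from independent.
  Summing over the earlier indices first leaves one term per new particle which, once the past is
  fixed, depends only on its ancestor and its position. Backward probabilities add up to 1, so this
  term is bounded by a constant times the sup norm of \<open>h\<close>, whatever \<open>N\<close>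
  is: the number of paths costs nothing. Test functions stay functions of whole paths, because
  \<open>L\<close> maps them to functions of shorter paths and the induction closes. The sums for
  \<open>h\<close> and for 1 are treated together because the random D_t disappears only from
  ratios. Ratios need denominators away from 0. Outside the bad events of time \<open>t\<close>, the
  upper bound on \<open>\<theta>\<close> keeps the predicted total mass above a fixed constant, and
  tolerances \<open>\<delta> \<le> 1\<close>, measured relative to the sup norm, keep the actual
  mass positive. Survival therefore follows from the same events that control the error. Tolerances
  above \<open>2 * osc T h\<close> are never reached, so \<open>\<delta> \<le> 1\<close> is no
  loss.\<close>

lemma (in prob_space) hoeffding_bounded_iid:
  assumes K: "finite K" "K \<noteq> {}"
    and indep: "indep_vars (\<lambda>_. borel) X K"
    and law: "\<And>i. i \<in> K \<Longrightarrow> distr M borel (X i) = D"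
    and bound: "\<And>i x. i \<in> K \<Longrightarrow> x \<in> space M \<Longrightarrow> \<bar>X i x\<bar> \<le> c"
    and c: "0 < c" and \<epsilon>: "0 \<le> \<epsilon>"
  shows "prob {x \<in> space M. \<epsilon> \<le> \<bar>(\<Sum>i\<in>K. X i x) / real (card K) - (\<integral>z. z \<partial>D)\<bar>}
    \<le> 2 * exp (- (real (card K) * \<epsilon>\<^sup>2 / (2 * c\<^sup>2)))"
proof -
  obtain i0 where i0: "i0 \<in> K" using K by auto
  have rv: "random_variable borel (X i0)"
    using indep i0 by (auto simp: indep_vars_def)
  interpret H: Hoeffding_ineq_iid M K X "X i0" "- c" c "expectation (X i0)"
  proof unfold_locales
    show "AE x in M. X i0 x \<in> {- c..c}"
      using bound[OF i0] by (intro AE_I2) (auto simp: abs_le_iff, smt (verit))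
  qed (use K indep law i0 rv in auto)
  have mean: "expectation (X i0) = (\<integral>z. z \<partial>D)"
    using law[OF i0] integral_distr[OF rv, of "\<lambda>z. z"] by simp
  \<comment> \<open>Hoeffding's exponent has the squared length of the range in its denominator;
    here the length is \<open>2 * c\<close>.\<close>
  have "- 2 * real (card K) * \<epsilon>\<^sup>2 / (c - - c)\<^sup>2 = - (real (card K) * \<epsilon>\<^sup>2 / (2 * c\<^sup>2))"
    using c by (simp add: field_simps power2_eq_square)
  then show ?thesis
    using H.Hoeffding_ineq_abs_ge'[OF \<epsilon> _ K(2)] c by (simp add: mean)
qed

text \<open>Given the past, the joint law of the sampled variables is a product measure; this is the
  form of the inequality that is applied at each fixed sample point.\<close>

lemma hoeffding_PiM:
  assumes K: "finite K" "K \<noteq> {}"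
    and D: "prob_space D"
    and f[measurable]: "f \<in> borel_measurable D"
    and bound: "\<And>x. x \<in> space D \<Longrightarrow> \<bar>f x\<bar> \<le> c"
    and c: "0 < c" and \<epsilon>: "0 \<le> \<epsilon>"
  shows "measure (PiM K (\<lambda>_. D))
      {x \<in> space (PiM K (\<lambda>_. D)). \<epsilon> \<le> \<bar>(\<Sum>i\<in>K. f (x i)) / real (card K) - (\<integral>z. f z \<partial>D)\<bar>}
    \<le> 2 * exp (- (real (card K) * \<epsilon>\<^sup>2 / (2 * c\<^sup>2)))"
proof -
  interpret D: prob_space D by fact
  interpret product_prob_space "\<lambda>_. D" K ..
  have law: "distr (PiM K (\<lambda>_. D)) D (\<lambda>x. x i) = D" if "i \<in> K" for i
    using PiM_component[OF that] by simp
  \<comment> \<open>The joint law of the coordinates is the product measure itself, since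
    restriction to \<open>K\<close> fixes the extensional points of the product space.\<close>
  have "P.indep_vars (\<lambda>_. D) (\<lambda>i x. x i) K"
  proof (subst P.indep_vars_iff_distr_eq_PiM'[OF K(2)])
    have "distr (PiM K (\<lambda>_. D)) (PiM K (\<lambda>_. D)) (\<lambda>x. \<lambda>i\<in>K. x i) =
        distr (PiM K (\<lambda>_. D)) (PiM K (\<lambda>_. D)) (\<lambda>x. x)"
      by (intro distr_cong refl) (auto simp: space_PiM PiE_def extensional_restrict)
    also have "\<dots> = PiM K (\<lambda>i. distr (PiM K (\<lambda>_. D)) D (\<lambda>x. x i))"
      by (auto simp: law intro!: PiM_cong)
    finally show "distr (PiM K (\<lambda>_. D)) (PiM K (\<lambda>_. D)) (\<lambda>x. \<lambda>i\<in>K. x i) =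
        PiM K (\<lambda>i. distr (PiM K (\<lambda>_. D)) D (\<lambda>x. x i))" .
  qed simp
  then have indep: "P.indep_vars (\<lambda>_. borel) (\<lambda>i x. f (x i)) K"
    by (rule P.indep_vars_compose2) simp
  have "distr (PiM K (\<lambda>_. D)) borel (\<lambda>x. f (x i)) = distr D borel f" if i: "i \<in> K" for i
  proof -
    have "distr (distr (PiM K (\<lambda>_. D)) D (\<lambda>x. x i)) borel f = distr (PiM K (\<lambda>_. D)) borel (\<lambda>x. f (x i))"
      using i by (subst distr_distr) (auto simp: comp_def)
    then show ?thesis by (simp add: law[OF i])
  qed
  from P.hoeffding_bounded_iid[OF K indep this _ c \<epsilon>]
  have "P.prob {x \<in> space (PiM K (\<lambda>_. D)).
      \<epsilon> \<le> \<bar>(\<Sum>i\<in>K. f (x i)) / real (card K) - (\<integral>z. z \<partial>distr D borel f)\<bar>}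
    \<le> 2 * exp (- (real (card K) * \<epsilon>\<^sup>2 / (2 * c\<^sup>2)))"
    using bound by (auto simp: space_PiM PiE_iff)
  also have "(\<integral>z. z \<partial>distr D borel f) = (\<integral>z. f z \<partial>D)"
    by (rule integral_distr) auto
  finally show ?thesis .
qed

text \<open>Boxes form an intersection-stable generator, and on them the product measure is a finite
  product of measurable functions of \<open>w\<close>.\<close>

lemma PiM_kernel_measurable:
  assumes K: "finite K" and k: "k \<in> F \<rightarrow>\<^sub>M prob_algebra S"
  shows "(\<lambda>w. PiM K (\<lambda>_. k w)) \<in> F \<rightarrow>\<^sub>M prob_algebra (PiM K (\<lambda>_. S))"
proof (rule measurable_prob_algebra_generated[OF sets_PiM Int_stable_prod_algebra prod_algebra_sets_into_space])
  fix w assume w: "w \<in> space F"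
  from measurable_space[OF k w] have kw: "prob_space (k w)" "sets (k w) = sets S"
    by (auto simp: space_prob_algebra)
  show "prob_space (PiM K (\<lambda>_. k w))" by (intro prob_space_PiM kw)
  show "sets (PiM K (\<lambda>_. k w)) = sets (PiM K (\<lambda>_. S))" by (intro sets_PiM_cong refl kw)
next
  fix A assume "A \<in> prod_algebra K (\<lambda>_. S)"
  then obtain X where A: "A = PiE K X" and X: "\<And>i. i \<in> K \<Longrightarrow> X i \<in> sets S"
    unfolding prod_algebra_eq_finite[OF K] by auto
  have [measurable]: "k \<in> F \<rightarrow>\<^sub>M subprob_algebra S"
    by (rule measurable_prob_algebraD) fact
  have "(\<lambda>w. emeasure (PiM K (\<lambda>_. k w)) A) \<in> borel_measurable F \<longleftrightarrow>
      (\<lambda>w. \<Prod>i\<in>K. emeasure (k w) (X i)) \<in> borel_measurable F"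
  proof (rule measurable_cong)
    fix w assume w: "w \<in> space F"
    from measurable_space[OF k w] have kw: "prob_space (k w)" "sets (k w) = sets S"
      by (auto simp: space_prob_algebra)
    interpret prob_space "k w" by (rule kw)
    interpret product_sigma_finite "\<lambda>_. k w" ..
    show "emeasure (PiM K (\<lambda>_. k w)) A = (\<Prod>i\<in>K. emeasure (k w) (X i))"
      unfolding A using X kw(2) K by (intro emeasure_PiM) auto
  qed
  also have "\<dots>"
  proof (rule borel_measurable_prod_ennreal)
    fix i assume "i \<in> K"
    show "(\<lambda>w. emeasure (k w) (X i)) \<in> borel_measurable F"
      using measurable_emeasure_kernel[of k F S "X i"] X[OF \<open>i \<in> K\<close>] by simp
  qed
  finally show "(\<lambda>w. emeasure (PiM K (\<lambda>_. k w)) A) \<in> borel_measurable F" .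
qed

text \<open>
  Conditional independence is only assumed for rectangles, with exceptional null sets depending on the
  rectangle; integrating first makes a Dynkin argument possible.
\<close>

lemma cond_iid_disintegration:
  assumes Pr: "prob_space Pr" and F: "subalgebra Pr F" and E: "E \<in> sets F" and K: "finite K"
    and iid: "cond_iid_on Pr F E K S X \<kappa>"
    and k: "k \<in> F \<rightarrow>\<^sub>M prob_algebra S"
    and \<kappa>: "\<And>w A. w \<in> E \<Longrightarrow> A \<in> sets S \<Longrightarrow> \<kappa> w A = measure (k w) A"
    and B: "B \<in> sets (F \<Otimes>\<^sub>M PiM K (\<lambda>_. S))"
  shows "emeasure Pr {w \<in> E. (w, \<lambda>i\<in>K. X i w) \<in> B} =
    (\<integral>\<^sup>+w. indicator E w * emeasure (PiM K (\<lambda>_. k w)) (Pair w -` B) \<partial>Pr)"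
proof -
  interpret prob_space Pr by fact
  interpret finite_measure_subalgebra Pr F by unfold_locales fact
  let ?S = "PiM K (\<lambda>_. S)"
  let ?k = "\<lambda>w. PiM K (\<lambda>_. k w)"
  let ?X = "\<lambda>w. \<lambda>i\<in>K. X i w"
  have spF: "space F = space Pr" and setsF: "sets F \<subseteq> sets Pr"
    using F by (auto simp: subalgebra_def)
  have idF: "(\<lambda>w. w) \<in> Pr \<rightarrow>\<^sub>M F"
    using spF setsF by (auto intro!: measurableI)
  have X[measurable]: "X i \<in> Pr \<rightarrow>\<^sub>M S" if "i \<in> K" for i
    using iid that by (auto simp: cond_iid_on_def)
  have Xm: "(\<lambda>w. (w, ?X w)) \<in> Pr \<rightarrow>\<^sub>M F \<Otimes>\<^sub>M ?S"
    by (intro measurable_Pair idF measurable_restrict X)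
  have km: "?k \<in> F \<rightarrow>\<^sub>M prob_algebra ?S"
    by (rule PiM_kernel_measurable[OF K k])
  have kwS: "sets (?k w) = sets ?S" "prob_space (?k w)" if "w \<in> space Pr" for w
    using measurable_space[OF km] that by (auto simp: space_prob_algebra spF)
  have EPr: "E \<in> sets Pr" using E setsF by auto
  have Esp: "E \<subseteq> space Pr" using sets.sets_into_space[OF EPr] .
  have km': "(\<lambda>w. indicator E w * emeasure (?k w) (Pair w -` B)) \<in> borel_measurable Pr"
    if B: "B \<in> sets (F \<Otimes>\<^sub>M ?S)" for B
  proof -
    have "(\<lambda>w. emeasure (?k w) (Pair w -` B)) \<in> borel_measurable F"
    proof (rule emeasure_measurable_subprob_algebra2[OF _ measurable_prob_algebraD[OF km]])
      have "(SIGMA x:space F. Pair x -` B) = B"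
        using sets.sets_into_space[OF B] by (auto simp: space_pair_measure)
      then show "(SIGMA x:space F. Pair x -` B) \<in> sets (F \<Otimes>\<^sub>M ?S)" using B by simp
    qed
    from measurable_compose[OF idF this] show ?thesis
      using EPr by auto
  qed
  \<comment> \<open>The generator for the Dynkin argument: an \<open>F\<close>-measurable set times
    a box. Boxes are the sets for which \<open>iid\<close> gives the conditional
    probability.\<close>
  let ?Ea = "sets F" and ?Eb = "prod_algebra K (\<lambda>_. S)"
  let ?G = "{a \<times> b |a b. a \<in> ?Ea \<and> b \<in> ?Eb}"
  have bsp: "b \<subseteq> space ?S" if "b \<in> ?Eb" for b
    using subsetD[OF prod_algebra_sets_into_space that] by (simp add: space_PiM)
  have top: "space ?S \<in> ?Eb"
    unfolding prod_algebra_eq_finite[OF K] by (auto simp: space_PiM)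
  have "sets (F \<Otimes>\<^sub>M ?S) = sets (sigma (space F \<times> space ?S) ?G)"
  proof (rule sets_pair_eq[where Ca="{space F}" and Cb="{space ?S}"])
    show "?Ea \<subseteq> Pow (space F)" by (rule sets.space_closed)
    show "sets F = sigma_sets (space F) ?Ea" by (rule sets.sigma_sets_eq[symmetric])
    show "?Eb \<subseteq> Pow (space ?S)" using bsp by auto
    show "sets ?S = sigma_sets (space ?S) ?Eb" by (simp add: sets_PiM space_PiM)
  qed (use top in auto)
  also have "\<dots> = sigma_sets (space F \<times> space ?S) ?G"
    by (rule sets_measure_of) (use bsp sets.sets_into_space in blast)
  finally have gen: "sets (F \<Otimes>\<^sub>M ?S) = sigma_sets (space F \<times> space ?S) ?G" .
  have stable: "Int_stable ?G"
  proof (rule Int_stableI)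
    fix p q assume "p \<in> ?G" "q \<in> ?G"
    then obtain a b a' b' where "p = a \<times> b" "q = a' \<times> b'" "a \<in> ?Ea" "a' \<in> ?Ea" "b \<in> ?Eb" "b' \<in> ?Eb"
      by auto
    moreover from this have "b \<inter> b' \<in> ?Eb"
      using Int_stable_prod_algebra[of K "\<lambda>_. S"] by (auto simp: Int_stable_def)
    ultimately show "p \<inter> q \<in> ?G" by (auto simp: Times_Int_Times intro!: exI[of _ "a \<inter> a'"] exI[of _ "b \<inter> b'"])
  qed
  have closed: "?G \<subseteq> Pow (space F \<times> space ?S)"
    using bsp sets.sets_into_space by blast
  have meas: "{w \<in> E. (w, ?X w) \<in> A} \<in> sets Pr" if "A \<in> sets (F \<Otimes>\<^sub>M ?S)" for A
  proof -
    have "{w \<in> E. (w, ?X w) \<in> A} = E \<inter> ((\<lambda>w. (w, ?X w)) -` A \<inter> space Pr)"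
      using Esp by auto
    then show ?thesis using EPr measurable_sets[OF Xm that] by auto
  qed
  have "B \<in> sigma_sets (space F \<times> space ?S) ?G" using B gen by simp
  with stable closed show ?thesis
  proof (induction rule: sigma_sets_induct_disjoint)
    case (basic A)
    then obtain a b where A: "A = a \<times> b" and a: "a \<in> sets F" and "b \<in> ?Eb" by auto
    then obtain Y where b: "b = PiE K Y" and Y: "\<And>i. i \<in> K \<Longrightarrow> Y i \<in> sets S"
      unfolding prod_algebra_eq_finite[OF K] by auto
    let ?R = "{v \<in> space Pr. \<forall>i\<in>K. X i v \<in> Y i}"
    have R: "?R \<in> sets Pr"
    proof -
      have "?R = space Pr \<inter> (\<Inter>i\<in>K. X i -` Y i \<inter> space Pr)" by auto
      moreover have "(\<Inter>i\<in>K. X i -` Y i \<inter> space Pr) \<in> sets Pr" if "K \<noteq> {}"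
        using that K by (intro sets.finite_INT measurable_sets[OF X Y]) auto
      ultimately show ?thesis by (cases "K = {}") auto
    qed
    have aE: "a \<inter> E \<in> sets F" "a \<inter> E \<in> sets Pr" using a E setsF by auto
    \<comment> \<open>The null set may depend on the box; this does no harm, because the identity is
      only used under an integral over \<open>a \<inter> E\<close>.\<close>
    have ae: "AE w in Pr. w \<in> E \<longrightarrow> real_cond_exp Pr F (indicator ?R) w = (\<Prod>i\<in>K. \<kappa> w (Y i))"
      using iid Y by (auto simp: cond_iid_on_def)
    have pr: "(\<Prod>i\<in>K. \<kappa> w (Y i)) = measure (?k w) b" if w: "w \<in> E" for w
    proof -
      have kw: "prob_space (k w)" "sets (k w) = sets S"
        using measurable_space[OF k, of w] w Esp spF by (auto simp: space_prob_algebra)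
      interpret k: prob_space "k w" by (rule kw)
      interpret product_sigma_finite "\<lambda>_. k w" ..
      have "emeasure (?k w) b = (\<Prod>i\<in>K. emeasure (k w) (Y i))"
        unfolding b using Y kw(2) K by (intro emeasure_PiM) auto
      then have "measure (?k w) b = (\<Prod>i\<in>K. measure (k w) (Y i))"
        unfolding k.emeasure_eq_measure by (simp add: prod_ennreal measure_eq_emeasure_eq_ennreal prod_nonneg)
      then show ?thesis
        using \<kappa>[OF w] Y by simp
    qed
    have "emeasure Pr {w \<in> E. (w, ?X w) \<in> A} = emeasure Pr (a \<inter> E \<inter> ?R)"
      using Esp by (intro arg_cong[of _ _ "emeasure Pr"]) (auto simp: A b PiE_iff)
    also have "\<dots> = ennreal (\<integral>w\<in>a \<inter> E. indicator ?R w \<partial>Pr)"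
    proof -
      have "(\<integral>w\<in>a \<inter> E. indicator ?R w \<partial>Pr) = (\<integral>w. indicator (a \<inter> E \<inter> ?R) w \<partial>Pr)"
        unfolding set_lebesgue_integral_def
        by (intro Bochner_Integration.integral_cong) (auto simp: indicator_def)
      also have "\<dots> = measure Pr (a \<inter> E \<inter> ?R)" using aE R by simp
      finally show ?thesis by (simp add: emeasure_eq_measure)
    qed
    \<comment> \<open>\<open>a \<inter> E\<close> lies in \<open>F\<close>, so the indicator may be
      replaced by its conditional expectation.\<close>
    also have "(\<integral>w\<in>a \<inter> E. indicator ?R w \<partial>Pr) = (\<integral>w\<in>a \<inter> E. real_cond_exp Pr F (indicator ?R) w \<partial>Pr)"
      using R aE by (intro real_cond_exp_intA) (auto simp: emeasure_eq_measure)
    also have "\<dots> = (\<integral>w\<in>a \<inter> E. measure (?k w) b \<partial>Pr)"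
      unfolding set_lebesgue_integral_def
    proof (rule integral_cong_AE)
      have mk: "(\<lambda>w. measure (?k w) b) \<in> borel_measurable F"
        using measure_measurable_subprob_algebra2[of F "\<lambda>_. b" ?S ?k] measurable_prob_algebraD[OF km]
          \<open>b \<in> ?Eb\<close> by (simp add: sets_PiM space_PiM sigma_sets.Basic pair_measureI)
      have "(\<lambda>w. measure (?k w) b) \<in> borel_measurable Pr" using measurable_compose[OF idF mk] .
      then show "(\<lambda>w. indicat_real (a \<inter> E) w *\<^sub>R measure (?k w) b) \<in> borel_measurable Pr"
        using aE by auto
      show "(\<lambda>w. indicat_real (a \<inter> E) w *\<^sub>R real_cond_exp Pr F (indicator ?R) w) \<in> borel_measurable Pr"
        using aE by auto
      show "AE x in Pr. indicat_real (a \<inter> E) x *\<^sub>R real_cond_exp Pr F (indicat_real ?R) x =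
          indicat_real (a \<inter> E) x *\<^sub>R measure (?k x) b"
        using ae by eventually_elim (auto simp: indicator_def pr)
    qed
    also have "ennreal \<dots> = (\<integral>\<^sup>+w. ennreal (indicat_real (a \<inter> E) w *\<^sub>R measure (?k w) b) \<partial>Pr)"
      unfolding set_lebesgue_integral_def
    proof (rule nn_integral_eq_integral[symmetric])
      have mk: "(\<lambda>w. measure (?k w) b) \<in> borel_measurable F"
        using measure_measurable_subprob_algebra2[of F "\<lambda>_. b" ?S ?k] measurable_prob_algebraD[OF km]
          \<open>b \<in> ?Eb\<close> by (simp add: sets_PiM space_PiM sigma_sets.Basic pair_measureI)
      have "(\<lambda>w. measure (?k w) b) \<in> borel_measurable Pr" using measurable_compose[OF idF mk] .
      then have "(\<lambda>w. indicat_real (a \<inter> E) w *\<^sub>R measure (?k w) b) \<in> borel_measurable Pr"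
        using aE by auto
      then show "integrable Pr (\<lambda>w. indicat_real (a \<inter> E) w *\<^sub>R measure (?k w) b)"
        using kwS(2) by (intro integrable_const_bound[where B=1] AE_I2)
          (auto simp: indicator_def prob_space.prob_le_1)
    qed auto
    also have "\<dots> = (\<integral>\<^sup>+w. indicator E w * emeasure (?k w) (Pair w -` A) \<partial>Pr)"
    proof (rule nn_integral_cong)
      fix w assume "w \<in> space Pr"
      then interpret k: prob_space "?k w" by (rule kwS)
      have "Pair w -` A = (if w \<in> a then b else {})" by (auto simp: A)
      then show "ennreal (indicat_real (a \<inter> E) w *\<^sub>R measure (?k w) b) =
          indicator E w * emeasure (?k w) (Pair w -` A)"
        by (auto simp: k.emeasure_eq_measure indicator_def)
    qed
    finally show ?case .
  next
    case empty
    show ?case by simp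
  next
    case (compl A)
    have A: "A \<in> sets (F \<Otimes>\<^sub>M ?S)" using compl gen by simp
    let ?A' = "space F \<times> space ?S - A"
    have A': "?A' \<in> sets (F \<Otimes>\<^sub>M ?S)"
      using sets.compl_sets[OF A] by (simp add: space_pair_measure)
    have fin: "emeasure Pr {w \<in> E. (w, ?X w) \<in> A} \<noteq> \<infinity>" by simp
    have "{w \<in> E. (w, ?X w) \<in> ?A'} = E - {w \<in> E. (w, ?X w) \<in> A}"
      using Esp spF measurable_space[OF Xm] by (auto simp: space_pair_measure)
    then have "emeasure Pr {w \<in> E. (w, ?X w) \<in> ?A'} = emeasure Pr E - emeasure Pr {w \<in> E. (w, ?X w) \<in> A}"
      using meas[OF A] EPr by (simp add: emeasure_Diff subset_eq)
    also have "\<dots> = (\<integral>\<^sup>+w. indicator E w \<partial>Pr) -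
        (\<integral>\<^sup>+w. indicator E w * emeasure (?k w) (Pair w -` A) \<partial>Pr)"
      unfolding compl(2) using EPr by simp
    also have "\<dots> = (\<integral>\<^sup>+w. indicator E w - indicator E w * emeasure (?k w) (Pair w -` A) \<partial>Pr)"
    proof (rule nn_integral_diff[symmetric])
      show "AE x in Pr. indicator E x * emeasure (?k x) (Pair x -` A) \<le> indicator E x"
        by (intro AE_I2) (auto simp: indicator_def intro!: prob_space.emeasure_le_1 kwS)
      show "(\<integral>\<^sup>+ x. indicator E x * emeasure (?k x) (Pair x -` A) \<partial>Pr) \<noteq> \<infinity>"
        using fin unfolding compl(2) .
    qed (use km'[OF A] EPr in auto)
    also have "\<dots> = (\<integral>\<^sup>+w. indicator E w * emeasure (?k w) (Pair w -` ?A') \<partial>Pr)"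
    proof (rule nn_integral_cong)
      fix w assume w: "w \<in> space Pr"
      interpret k: prob_space "?k w" by (rule kwS) fact
      have "Pair w -` ?A' = space (?k w) - Pair w -` A"
        using w spF sets_eq_imp_space_eq[OF kwS(1)[OF w]] by auto
      moreover have "Pair w -` A \<in> sets (?k w)"
        using sets_Pair1[OF A] kwS(1)[OF w] by simp
      ultimately show "indicator E w - indicator E w * emeasure (?k w) (Pair w -` A) =
          indicator E w * emeasure (?k w) (Pair w -` ?A')"
        by (auto simp: indicator_def emeasure_compl k.emeasure_space_1)
    qed
    finally show ?case .
  next
    case (union A)
    have A: "A i \<in> sets (F \<Otimes>\<^sub>M ?S)" for i using union gen by auto
    have "emeasure Pr {w \<in> E. (w, ?X w) \<in> (\<Union>i. A i)} = emeasure Pr (\<Union>i. {w \<in> E. (w, ?X w) \<in> A i})"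
      by (intro arg_cong[of _ _ "emeasure Pr"]) auto
    also have "\<dots> = (\<Sum>i. emeasure Pr {w \<in> E. (w, ?X w) \<in> A i})"
      using union(1) meas[OF A] by (intro suminf_emeasure[symmetric]) (auto simp: disjoint_family_on_def)
    also have "\<dots> = (\<Sum>i. \<integral>\<^sup>+w. indicator E w * emeasure (?k w) (Pair w -` A i) \<partial>Pr)"
      by (simp only: union(3))
    also have "\<dots> = (\<integral>\<^sup>+w. (\<Sum>i. indicator E w * emeasure (?k w) (Pair w -` A i)) \<partial>Pr)"
      by (intro nn_integral_suminf[symmetric] km' A)
    also have "\<dots> = (\<integral>\<^sup>+w. indicator E w * emeasure (?k w) (Pair w -` (\<Union>i. A i)) \<partial>Pr)"
    proof (rule nn_integral_cong)
      fix w assume w: "w \<in> space Pr"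
      have "(\<Sum>i. emeasure (?k w) (Pair w -` A i)) = emeasure (?k w) (\<Union>i. Pair w -` A i)"
        using union(1) sets_Pair1[OF A] kwS(1)[OF w]
        by (intro suminf_emeasure) (auto simp: disjoint_family_on_def)
      then show "(\<Sum>i. indicator E w * emeasure (?k w) (Pair w -` A i)) =
          indicator E w * emeasure (?k w) (Pair w -` (\<Union>i. A i))"
        by (simp add: vimage_UN)
    qed
    finally show ?case .
  qed
qed

text \<open>Pushing \<open>k x\<close> forward to the pairs with first component \<open>x\<close>
  makes the integrand independent of \<open>x\<close>; what is left is a fixed function integrated
  against a measurable kernel.\<close>

lemma integral_kernel_measurable:
  fixes f :: "'a \<Rightarrow> 'b \<Rightarrow> real"
  assumes f[measurable]: "(\<lambda>(x, y). f x y) \<in> borel_measurable (M \<Otimes>\<^sub>M N)"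
    and k[measurable]: "k \<in> M \<rightarrow>\<^sub>M subprob_algebra N"
  shows "(\<lambda>x. \<integral>y. f x y \<partial>k x) \<in> borel_measurable M"
proof -
  note measurable_distr2[measurable]
  have "(\<lambda>x. \<integral>z. (\<lambda>(x, y). f x y) z \<partial>distr (k x) (M \<Otimes>\<^sub>M N) (\<lambda>y. (x, y))) \<in> borel_measurable M"
    by measurable
  also have "?this \<longleftrightarrow> ?thesis"
  proof (rule measurable_cong)
    fix x assume x: "x \<in> space M"
    then have "sets (k x) = sets N" using sets_kernel[OF k] by auto
    then have "(\<lambda>y. (x, y)) \<in> k x \<rightarrow>\<^sub>M M \<Otimes>\<^sub>M N"
      using x by (simp cong: measurable_cong_sets)
    from integral_distr[OF this f]
    show "(\<integral>z. (\<lambda>(x, y). f x y) z \<partial>distr (k x) (M \<Otimes>\<^sub>M N) (\<lambda>y. (x, y))) = (\<integral>y. f x y \<partial>k x)"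
      by simp
  qed
  finally show ?thesis .
qed

text \<open>The function \<open>f\<close> may depend on \<open>w\<close> through the sigma-field
  \<open>F\<close>. The bad event is a set of pairs of \<open>w\<close> and a sample, and the
  disintegration turns its probability into an average over \<open>w\<close> of probabilities under
  product measures, each bounded by \<open>hoeffding_PiM\<close>.\<close>

lemma
  assumes Pr: "prob_space Pr" and F: "subalgebra Pr F" and E: "E \<in> sets F"
    and K: "finite K" "K \<noteq> {}"
    and iid: "cond_iid_on Pr F E K S X \<kappa>"
    and k: "\<And>w. w \<in> E \<Longrightarrow> prob_space (k w)" "\<And>w. w \<in> E \<Longrightarrow> sets (k w) = sets S"
    and km: "\<And>A. A \<in> sets S \<Longrightarrow> (\<lambda>w. measure (k w) A) \<in> borel_measurable F"
    and \<kappa>: "\<And>w A. w \<in> E \<Longrightarrow> A \<in> sets S \<Longrightarrow> \<kappa> w A = measure (k w) A"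
    and f: "(\<lambda>(w, x). f w x) \<in> borel_measurable (F \<Otimes>\<^sub>M S)"
    and bound: "\<And>w x. w \<in> E \<Longrightarrow> x \<in> space S \<Longrightarrow> \<bar>f w x\<bar> \<le> c"
    and c: "0 < c" and \<epsilon>: "0 \<le> \<epsilon>"
  shows cond_hoeffding_sets:
      "{w \<in> E. \<epsilon> \<le> \<bar>(\<Sum>i\<in>K. f w (X i w)) / real (card K) - (\<integral>x. f w x \<partial>k w)\<bar>} \<in> sets Pr" (is "?A \<in> _")
    and cond_hoeffding:
      "measure Pr {w \<in> E. \<epsilon> \<le> \<bar>(\<Sum>i\<in>K. f w (X i w)) / real (card K) - (\<integral>x. f w x \<partial>k w)\<bar>}
        \<le> 2 * exp (- (real (card K) * \<epsilon>\<^sup>2 / (2 * c\<^sup>2)))" (is "_ \<le> ?b")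
proof -
  interpret prob_space Pr by fact
  note [measurable] = f
  have spF: "space F = space Pr" and setsF: "sets F \<subseteq> sets Pr"
    using F by (auto simp: subalgebra_def)
  have idF: "(\<lambda>w. w) \<in> Pr \<rightarrow>\<^sub>M F"
    using spF setsF by (auto intro!: measurableI)
  have EPr: "E \<in> sets Pr" using E setsF by auto
  have Esp: "E \<subseteq> space Pr" using sets.sets_into_space[OF EPr] .
  have X[measurable]: "X i \<in> Pr \<rightarrow>\<^sub>M S" if "i \<in> K" for i
    using iid that by (auto simp: cond_iid_on_def)
  have "?A \<in> sets Pr \<and> measure Pr ?A \<le> ?b"
  proof (cases "E = {}")
    case False
    then obtain w0 where w0: "w0 \<in> E" by auto
    \<comment> \<open>Outside \<open>E\<close> nothing makes \<open>k\<close> a probability kernel.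
      A fixed value \<open>k w0\<close> with \<open>w0 \<in> E\<close> is used there, and the factor
      \<open>indicator E w\<close> removes its effect.\<close>
    define k' where "k' w = (if w \<in> E then k w else k w0)" for w
    have k': "prob_space (k' w)" "sets (k' w) = sets S" for w
      using k w0 by (auto simp: k'_def)
    have "k' \<in> F \<rightarrow>\<^sub>M prob_algebra S"
    proof (rule measurable_prob_algebra_generated[OF sets.sigma_sets_eq[symmetric] sets.Int_stable sets.space_closed])
      fix A assume A: "A \<in> sets S"
      have "emeasure (k' w) A = ennreal (if w \<in> E then measure (k w) A else measure (k w0) A)" for w
      proof -
        interpret k': prob_space "k' w" by (rule k')
        show ?thesis unfolding k'.emeasure_eq_measure by (simp add: k'_def)
      qed
      then show "(\<lambda>w. emeasure (k' w) A) \<in> borel_measurable F"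
        using km[OF A] E by simp
    qed (use k' in auto)
    note k'm = this
    have k'm'[measurable]: "k' \<in> F \<rightarrow>\<^sub>M subprob_algebra S"
      by (rule measurable_prob_algebraD) fact
    let ?S = "PiM K (\<lambda>_. S)"
    let ?bad = "\<lambda>w x. \<epsilon> \<le> \<bar>(\<Sum>i\<in>K. f w (x i)) / real (card K) - (\<integral>z. f w z \<partial>k' w)\<bar>"
    let ?B = "{p \<in> space (F \<Otimes>\<^sub>M ?S). ?bad (fst p) (snd p)}"
    have [measurable]: "(\<lambda>w. \<integral>z. f w z \<partial>k' w) \<in> borel_measurable F"
      by (rule integral_kernel_measurable[OF f k'm'])
    have [measurable]: "(\<lambda>p. f (fst p) (snd p i)) \<in> borel_measurable (F \<Otimes>\<^sub>M ?S)" if "i \<in> K" for i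
    proof -
      have "(\<lambda>p. (fst p, snd p i)) \<in> F \<Otimes>\<^sub>M ?S \<rightarrow>\<^sub>M F \<Otimes>\<^sub>M S"
        using that by (intro measurable_Pair measurable_fst measurable_compose[OF measurable_snd measurable_component_singleton])
      from measurable_compose[OF this f] show ?thesis by simp
    qed
    have B: "?B \<in> sets (F \<Otimes>\<^sub>M ?S)" by measurable
    have Xm: "(\<lambda>w. (w, \<lambda>i\<in>K. X i w)) \<in> Pr \<rightarrow>\<^sub>M F \<Otimes>\<^sub>M ?S"
      by (intro measurable_Pair idF measurable_restrict X)
    have A_eq: "?A = {w \<in> E. (w, \<lambda>i\<in>K. X i w) \<in> ?B}"
    proof -
      have "(w, \<lambda>i\<in>K. X i w) \<in> space (F \<Otimes>\<^sub>M ?S)" if "w \<in> E" for w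
        using measurable_space[OF Xm] that Esp by auto
      then show ?thesis by (auto simp: k'_def)
    qed
    have "?A = E \<inter> ((\<lambda>w. (w, \<lambda>i\<in>K. X i w)) -` ?B \<inter> space Pr)"
      unfolding A_eq using Esp by auto
    then have A: "?A \<in> sets Pr" using EPr measurable_sets[OF Xm B] by auto
    have "emeasure Pr ?A = (\<integral>\<^sup>+w. indicator E w * emeasure (PiM K (\<lambda>_. k' w)) (Pair w -` ?B) \<partial>Pr)"
      unfolding A_eq
      by (rule cond_iid_disintegration[OF Pr F E K(1) iid k'm _ B]) (simp add: \<kappa> k'_def)
    also have "\<dots> \<le> (\<integral>\<^sup>+w. ennreal ?b \<partial>Pr)"
    proof (rule nn_integral_mono)
      fix w assume w: "w \<in> space Pr"
      show "indicator E w * emeasure (PiM K (\<lambda>_. k' w)) (Pair w -` ?B) \<le> ennreal ?b"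
      proof (cases "w \<in> E")
        case True
        interpret P: prob_space "PiM K (\<lambda>_. k' w)" by (intro prob_space_PiM k')
        have sp: "space (PiM K (\<lambda>_. k' w)) = space ?S"
          by (intro sets_eq_imp_space_eq sets_PiM_cong k' refl)
        have fw: "f w \<in> borel_measurable (k' w)"
        proof -
          have "f w \<in> borel_measurable S"
            using measurable_compose[OF measurable_Pair1' f, of w] w spF by simp
          then show ?thesis using k'(2)[of w] by (simp cong: measurable_cong_sets)
        qed
        have "Pair w -` ?B = {x \<in> space (PiM K (\<lambda>_. k' w)). ?bad w x}"
          unfolding sp using w spF by (auto simp: space_pair_measure)
        moreover have "P.prob {x \<in> space (PiM K (\<lambda>_. k' w)). ?bad w x} \<le> ?b"
          using hoeffding_PiM[OF K k'(1) fw _ c \<epsilon>] bound[OF True] sets_eq_imp_space_eq[OF k'(2)[of w]] by auto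
        ultimately show ?thesis using True by (simp add: P.emeasure_eq_measure)
      qed simp
    qed
    also have "\<dots> = ennreal ?b" by (simp add: emeasure_space_1)
    finally show ?thesis using A by (simp add: emeasure_eq_measure)
  qed auto
  then show "?A \<in> sets Pr" "measure Pr ?A \<le> ?b" by auto
qed

section \<open>The unnormalised smoothing recursion\<close>

definition transition ::
    "('x \<Rightarrow> 'x measure) \<Rightarrow> (nat \<Rightarrow> 'x \<Rightarrow> real) \<Rightarrow> nat \<Rightarrow> ((nat \<Rightarrow> 'x) \<Rightarrow> real) \<Rightarrow> (nat \<Rightarrow> 'x) \<Rightarrow> real" where
  "transition M G t h x = (\<integral>x'. G (Suc t) x' * h (x(Suc t := x')) \<partial>M (x t))"

text \<open>The definition peels off the first coordinate, whereas induction over the time horizon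
  has to peel off the last one. The last integral, with its likelihood factor, moves into the
  integrand as \<open>transition\<close>.\<close>

lemma joint_integral_from_Suc:
  "joint_integral_from M G h s (Suc k) x = joint_integral_from M G (transition M G (s + k) h) s k x"
proof (induction k arbitrary: s x)
  case 0
  show ?case by (simp add: transition_def)
next
  case (Suc k)
  show ?case
    unfolding joint_integral_from.simps(2)[of M G h s] joint_integral_from.simps(2)[of M G "transition M G (s + Suc k) h" s] Suc by simp
qed

lemma joint_integral_0: "joint_integral \<chi>0 M G 0 h = (\<integral>x. G 0 x * h ((\<lambda>_. undefined)(0 := x)) \<partial>\<chi>0)"
  by (simp add: joint_integral_def)

lemma joint_integral_Suc: "joint_integral \<chi>0 M G (Suc t) h = joint_integral \<chi>0 M G t (transition M G t h)"
  unfolding joint_integral_def joint_integral_from_Suc by simp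

section \<open>Paths as extensional functions: measurability and boundedness\<close>

lemma singleton_path_in_space: "(\<lambda>_. undefined)(0 := x) \<in> space (Pi\<^sub>M {..0::nat} (\<lambda>_. borel))"
  by (auto simp: space_PiM PiE_iff extensional_def)

lemma path_upd_in_space:
  "x \<in> space (Pi\<^sub>M {..t} (\<lambda>_. borel)) \<Longrightarrow> x(Suc t := z) \<in> space (Pi\<^sub>M {..Suc t} (\<lambda>_. borel))"
  by (auto simp: space_PiM PiE_iff extensional_def)

lemma singleton_path_measurable[measurable]:
  "(\<lambda>x. (\<lambda>_. undefined)(0 := x)) \<in> borel \<rightarrow>\<^sub>M Pi\<^sub>M {..0::nat} (\<lambda>_. borel)"
proof -
  have "(\<lambda>x i. ((\<lambda>_. undefined)(0 := x)) i) \<in> borel \<rightarrow>\<^sub>M Pi\<^sub>M {..0::nat} (\<lambda>_. borel)"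
    by (rule measurable_PiM_single') (auto simp: extensional_def split: if_splits)
  then show ?thesis by simp
qed

lemma path_upd_measurable[measurable]:
  "(\<lambda>(x, z). x(Suc t := z)) \<in> Pi\<^sub>M {..t} (\<lambda>_. borel) \<Otimes>\<^sub>M borel \<rightarrow>\<^sub>M Pi\<^sub>M {..Suc t} (\<lambda>_. borel)"
  using measurable_add_dim[of "Suc t" "{..t}" "\<lambda>_. borel"] by (simp add: atMost_Suc)

text \<open>The integration starts from the path that is \<open>undefined\<close> everywhere and
  fills in the coordinates up to \<open>t\<close>, so it meets extensional paths only.\<close>

lemma joint_integral_cong:
  assumes "\<And>x. x \<in> space (Pi\<^sub>M {..t} (\<lambda>_. borel)) \<Longrightarrow> h x = h' x"
  shows "joint_integral \<chi>0 M G t h = joint_integral \<chi>0 M G t h'"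
  using assms
proof (induction t arbitrary: h h')
  case 0
  then show ?case unfolding joint_integral_0
    by (intro Bochner_Integration.integral_cong refl) (simp only: singleton_path_in_space)
next
  case (Suc t)
  show ?case unfolding joint_integral_Suc transition_def
    by (intro Suc.IH Bochner_Integration.integral_cong refl) (simp only: Suc.prems path_upd_in_space)
qed

lemma bounded_measurableI:
  assumes "h \<in> borel_measurable (Pi\<^sub>M {..t} (\<lambda>_. borel))"
    and "\<And>x. x \<in> space (Pi\<^sub>M {..t} (\<lambda>_. borel)) \<Longrightarrow> \<bar>h x\<bar> \<le> c"
  shows "h \<in> bounded_measurable t"
  using assms by (auto simp: bounded_measurable_def bounded_iff)

lemma bounded_measurableD:
  assumes "h \<in> bounded_measurable t"
  shows "h \<in> borel_measurable (Pi\<^sub>M {..t} (\<lambda>_. borel))"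
    and "\<exists>c. \<forall>x\<in>space (Pi\<^sub>M {..t} (\<lambda>_. borel)). \<bar>h x\<bar> \<le> c"
  using assms by (auto simp: bounded_measurable_def bounded_iff)

lemma bounded_measurable_const: "(\<lambda>_. c) \<in> bounded_measurable t"
  by (rule bounded_measurableI) auto

lemma bounded_measurable_lincomb:
  assumes "h1 \<in> bounded_measurable t" "h2 \<in> bounded_measurable t"
  shows "(\<lambda>x. a * h1 x + b * h2 x) \<in> bounded_measurable t"
proof -
  obtain c1 c2 where c: "\<And>x. x \<in> space (Pi\<^sub>M {..t} (\<lambda>_. borel)) \<Longrightarrow> \<bar>h1 x\<bar> \<le> c1"
      "\<And>x. x \<in> space (Pi\<^sub>M {..t} (\<lambda>_. borel)) \<Longrightarrow> \<bar>h2 x\<bar> \<le> c2"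
    using assms[THEN bounded_measurableD(2)] by auto
  show ?thesis
  proof (rule bounded_measurableI)
    show "(\<lambda>x. a * h1 x + b * h2 x) \<in> borel_measurable (Pi\<^sub>M {..t} (\<lambda>_. borel))"
      using assms[THEN bounded_measurableD(1)] by measurable
  next
    fix x :: "nat \<Rightarrow> 'a" assume x: "x \<in> space (Pi\<^sub>M {..t} (\<lambda>_. borel))"
    have "\<bar>a * h1 x + b * h2 x\<bar> \<le> \<bar>a\<bar> * \<bar>h1 x\<bar> + \<bar>b\<bar> * \<bar>h2 x\<bar>"
      using abs_triangle_ineq[of "a * h1 x" "b * h2 x"] by (simp add: abs_mult)
    also have "\<dots> \<le> \<bar>a\<bar> * c1 + \<bar>b\<bar> * c2"
      using c[OF x] by (intro add_mono mult_left_mono) auto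
    finally show "\<bar>a * h1 x + b * h2 x\<bar> \<le> \<bar>a\<bar> * c1 + \<bar>b\<bar> * c2" .
  qed
qed

text \<open>The sup norm assumptions as real upper bounds. One-sided bounds suffice because the
  functions are nonnegative; \<open>K\<omega>\<close> serves the initial and all later
  weights.\<close>

locale bounded_smc_model = smc_model \<chi>0 \<nu> M m g y T \<rho>0 r0 \<theta> P p
  for \<chi>0 \<nu> :: "'x::polish_space measure" and M m and g :: "'x \<Rightarrow> 'y::polish_space \<Rightarrow> real" and y T \<rho>0 r0 \<theta> P p +
  fixes Kg K\<theta> K\<omega> :: real
  assumes K_pos: "0 < Kg" "0 < K\<theta>" "0 < K\<omega>"
    and lik_le: "\<And>t x. t \<le> T \<Longrightarrow> lik g y t x \<le> Kg"
    and \<theta>_le: "\<And>t x. t \<in> {1..T} \<Longrightarrow> \<theta> t x \<le> K\<theta>"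
    and weight_init_le: "\<And>x. weight_init r0 (lik g y) x \<le> K\<omega>"
    and weight_step_le: "\<And>t x x'. t \<in> {1..T} \<Longrightarrow> weight_step m (lik g y) \<theta> p t x x' \<le> K\<omega>"
begin

abbreviation G where "G \<equiv> lik g y"
abbreviation pathspace :: "nat \<Rightarrow> (nat \<Rightarrow> 'x) measure" where "pathspace t \<equiv> Pi\<^sub>M {..t} (\<lambda>_. borel)"
abbreviation L where "L \<equiv> transition M G"
abbreviation \<gamma> where "\<gamma> \<equiv> joint_integral \<chi>0 M G"

lemma G_nonneg: "0 \<le> G t x"
  by (simp add: lik_def g_nonneg)

lemma G_measurable[measurable]: "G t \<in> borel_measurable borel"
  using measurable_compose[OF measurable_Pair2' g_meas, of "y t"] by (simp add: lik_def[abs_def])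

lemma M_prob: "prob_space (M x)" and sets_M: "sets (M x) = sets borel"
  using measurable_space[OF M_kernel, of x] by (auto simp: space_prob_algebra)

lemma step_integrable:
  assumes h: "h \<in> bounded_measurable (Suc t)" and t: "Suc t \<le> T" and x: "x \<in> space (pathspace t)"
  shows "integrable (M (x t)) (\<lambda>x'. G (Suc t) x' * h (x(Suc t := x')))"
proof -
  interpret prob_space "M (x t)" by (rule M_prob)
  obtain c where c: "\<And>x. x \<in> space (pathspace (Suc t)) \<Longrightarrow> \<bar>h x\<bar> \<le> c"
    using bounded_measurableD(2)[OF h] by auto
  note hm = bounded_measurableD(1)[OF h]
  have "(\<lambda>x'. h (x(Suc t := x'))) \<in> borel_measurable borel"
    using measurable_compose[OF measurable_compose[OF measurable_Pair1'[OF x] path_upd_measurable] hm] by simp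
  then have "(\<lambda>x'. G (Suc t) x' * h (x(Suc t := x'))) \<in> borel_measurable borel" by measurable
  then have m: "(\<lambda>x'. G (Suc t) x' * h (x(Suc t := x'))) \<in> borel_measurable (M (x t))"
    using sets_M by (simp cong: measurable_cong_sets)
  show ?thesis
  proof (rule integrable_const_bound[OF AE_I2 m])
    fix x'
    show "norm (G (Suc t) x' * h (x(Suc t := x'))) \<le> Kg * c"
      using lik_le[OF t, of x'] G_nonneg[of "Suc t" x'] c[OF path_upd_in_space[OF x]] K_pos
      by (auto simp: abs_mult intro!: mult_mono)
  qed
qed

lemma L_bound:
  assumes h: "h \<in> bounded_measurable (Suc t)" and t: "Suc t \<le> T" and x: "x \<in> space (pathspace t)"
    and c: "\<And>x. x \<in> space (pathspace (Suc t)) \<Longrightarrow> \<bar>h x\<bar> \<le> c"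
  shows "\<bar>L t h x\<bar> \<le> Kg * c"
proof -
  interpret prob_space "M (x t)" by (rule M_prob)
  have "norm (L t h x) \<le> (\<integral>x'. norm (G (Suc t) x' * h (x(Suc t := x'))) \<partial>M (x t))"
    unfolding transition_def by (rule integral_norm_bound)
  also have "\<dots> \<le> (\<integral>x'. Kg * c \<partial>M (x t))"
  proof (rule integral_mono)
    fix x'
    show "norm (G (Suc t) x' * h (x(Suc t := x'))) \<le> Kg * c"
      using lik_le[OF t, of x'] G_nonneg[of "Suc t" x'] c[OF path_upd_in_space[OF x]] K_pos
      by (auto simp: abs_mult intro!: mult_mono)
  qed (use step_integrable[OF h t x] in auto)
  also have "\<dots> = Kg * c" by (simp add: prob_space)
  finally show ?thesis by simp
qed

lemma L_bounded_measurable: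
  assumes h: "h \<in> bounded_measurable (Suc t)" and t: "Suc t \<le> T"
  shows "L t h \<in> bounded_measurable t"
proof -
  obtain c where c: "\<And>x. x \<in> space (pathspace (Suc t)) \<Longrightarrow> \<bar>h x\<bar> \<le> c"
    using bounded_measurableD(2)[OF h] by auto
  show ?thesis
  proof (rule bounded_measurableI)
    note hm = bounded_measurableD(1)[OF h]
    have [measurable]: "(\<lambda>p. h ((fst p)(Suc t := snd p))) \<in> borel_measurable (pathspace t \<Otimes>\<^sub>M borel)"
      using measurable_compose[OF path_upd_measurable hm] by (simp add: case_prod_beta)
    have "(\<lambda>(x, x'). G (Suc t) x' * h (x(Suc t := x'))) \<in> borel_measurable (pathspace t \<Otimes>\<^sub>M borel)"
      by (simp add: case_prod_beta)
    moreover have "(\<lambda>x. M (x t)) \<in> pathspace t \<rightarrow>\<^sub>M subprob_algebra borel"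
      by (rule measurable_compose[OF _ measurable_prob_algebraD[OF M_kernel]]) auto
    ultimately show "L t h \<in> borel_measurable (pathspace t)"
      unfolding transition_def[abs_def] by (rule integral_kernel_measurable)
  qed (rule L_bound[OF h t _ c])
qed

text \<open>Additivity needs integrability in every coordinate, as a non-integrable function has
  integral 0 by convention. It comes from the bounds on \<open>h1\<close>, \<open>h2\<close> and the
  likelihoods.\<close>

lemma \<gamma>_lincomb:
  assumes "h1 \<in> bounded_measurable t" "h2 \<in> bounded_measurable t" "t \<le> T"
  shows "\<gamma> t (\<lambda>x. a * h1 x + b * h2 x) = a * \<gamma> t h1 + b * \<gamma> t h2"
  using assms
proof (induction t arbitrary: h1 h2)
  case 0
  interpret prob_space \<chi>0 by (rule init_prob)
  have int: "integrable \<chi>0 (\<lambda>x. G 0 x * h ((\<lambda>_. undefined)(0 := x)))" if h: "h \<in> bounded_measurable 0" for h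
  proof -
    obtain c where c: "\<And>x. x \<in> space (pathspace 0) \<Longrightarrow> \<bar>h x\<bar> \<le> c"
      using bounded_measurableD(2)[OF h] by auto
    note [measurable] = bounded_measurableD(1)[OF h]
    have "(\<lambda>x. G 0 x * h ((\<lambda>_. undefined)(0 := x))) \<in> borel_measurable borel" by measurable
    then have m: "(\<lambda>x. G 0 x * h ((\<lambda>_. undefined)(0 := x))) \<in> borel_measurable \<chi>0"
      using init_prob by (simp cong: measurable_cong_sets)
    show ?thesis
    proof (rule integrable_const_bound[OF AE_I2 m])
      fix x
      show "norm (G 0 x * h ((\<lambda>_. undefined)(0 := x))) \<le> Kg * c"
        using lik_le[of 0 x] G_nonneg[of 0 x] c[OF singleton_path_in_space, of x] K_pos
        by (auto simp: abs_mult intro!: mult_mono)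
    qed
  qed
  have "\<gamma> 0 (\<lambda>x. a * h1 x + b * h2 x) = (\<integral>x. a * (G 0 x * h1 ((\<lambda>_. undefined)(0 := x))) +
      b * (G 0 x * h2 ((\<lambda>_. undefined)(0 := x))) \<partial>\<chi>0)"
    unfolding joint_integral_0 by (intro Bochner_Integration.integral_cong) (auto simp: algebra_simps)
  then show ?case
    unfolding joint_integral_0 using int 0 by simp
next
  case (Suc t)
  have "\<gamma> (Suc t) (\<lambda>x. a * h1 x + b * h2 x) = \<gamma> t (\<lambda>x. a * L t h1 x + b * L t h2 x)"
    unfolding joint_integral_Suc
  proof (rule joint_integral_cong)
    fix x assume x: "x \<in> space (pathspace t)"
    have "L t (\<lambda>x. a * h1 x + b * h2 x) x =
       (\<integral>x'. a * (G (Suc t) x' * h1 (x(Suc t := x'))) + b * (G (Suc t) x' * h2 (x(Suc t := x'))) \<partial>M (x t))"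
      unfolding transition_def by (intro Bochner_Integration.integral_cong) (auto simp: algebra_simps)
    then show "L t (\<lambda>x. a * h1 x + b * h2 x) x = a * L t h1 x + b * L t h2 x"
      unfolding transition_def using step_integrable[OF _ _ x] Suc.prems by simp
  qed
  then show ?case
    using Suc.IH L_bounded_measurable Suc.prems by (simp add: joint_integral_Suc)
qed

lemma \<gamma>_nonneg:
  assumes "\<And>x. x \<in> space (pathspace t) \<Longrightarrow> 0 \<le> h x"
  shows "0 \<le> \<gamma> t h"
  using assms
proof (induction t arbitrary: h)
  case 0
  show ?case unfolding joint_integral_0
    by (intro integral_nonneg_AE AE_I2 mult_nonneg_nonneg G_nonneg 0 singleton_path_in_space)
next
  case (Suc t)
  show ?case unfolding joint_integral_Suc
    by (intro Suc.IH) (auto simp: transition_def intro!: integral_nonneg_AE mult_nonneg_nonneg G_nonneg Suc.prems path_upd_in_space)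
qed

text \<open>Positivity of \<open>\<gamma> t\<close>, applied to \<open>c + h\<close> and to
  \<open>c - h\<close>.\<close>

lemma \<gamma>_abs_le:
  assumes h: "h \<in> bounded_measurable t" and t: "t \<le> T"
    and c: "\<And>x. x \<in> space (pathspace t) \<Longrightarrow> \<bar>h x\<bar> \<le> c"
  shows "\<bar>\<gamma> t h\<bar> \<le> c * \<gamma> t (\<lambda>_. 1)"
proof -
  have "0 \<le> \<gamma> t (\<lambda>x. c * 1 + b * h x)" if b: "\<bar>b\<bar> = 1" for b
  proof (rule \<gamma>_nonneg)
    fix x :: "nat \<Rightarrow> 'x" assume "x \<in> space (pathspace t)"
    from c[OF this] b have "\<bar>b * h x\<bar> \<le> c" by (simp add: abs_mult)
    then show "0 \<le> c * 1 + b * h x" by linarith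
  qed
  then have "0 \<le> c * \<gamma> t (\<lambda>_. 1) + b * \<gamma> t h" if "\<bar>b\<bar> = 1" for b
    using \<gamma>_lincomb[OF bounded_measurable_const[of 1] h t, of c b] that by metis
  from this[of 1] this[of "-1"] show ?thesis by (simp add: abs_le_iff)
qed

text \<open>Positivity is assumed at time \<open>T\<close>. Downwards in time it is inherited,
  because the normalizer at \<open>Suc t\<close> is at most \<open>Kg\<close> times the one at
  \<open>t\<close>.\<close>

lemma \<gamma>_1_pos: "t \<le> T \<Longrightarrow> 0 < \<gamma> t (\<lambda>_. 1)"
proof (induction rule: inc_induct)
  case base
  show ?case by (rule normalizer_pos)
next
  case (step t)
  have "\<bar>\<gamma> t (L t (\<lambda>_. 1))\<bar> \<le> Kg * 1 * \<gamma> t (\<lambda>_. 1)"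
    using step by (intro \<gamma>_abs_le L_bounded_measurable L_bound) (auto simp: bounded_measurable_const)
  then have "0 < Kg * \<gamma> t (\<lambda>_. 1)"
    using step.IH by (simp add: joint_integral_Suc)
  then show ?case using K_pos by (simp add: zero_less_mult_iff)
qed

end

section \<open>Path sums of weighted particles\<close>

lemma sum_PiE_insert:
  assumes "a \<notin> A" "finite A" "finite B"
  shows "(\<Sum>j\<in>insert a A \<rightarrow>\<^sub>E B. f j) = (\<Sum>i\<in>B. \<Sum>j\<in>A \<rightarrow>\<^sub>E B. f (j(a := i)))"
proof -
  have "(\<Sum>j\<in>insert a A \<rightarrow>\<^sub>E B. f j) = (\<Sum>(i, j)\<in>B \<times> (A \<rightarrow>\<^sub>E B). f (j(a := i)))"
    unfolding PiE_insert_eq using assms(1)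
    by (subst sum.reindex[OF inj_combinator]) (auto simp: comp_def case_prod_beta)
  also have "\<dots> = (\<Sum>i\<in>B. \<Sum>j\<in>A \<rightarrow>\<^sub>E B. f (j(a := i)))"
    by (rule sum.cartesian_product[symmetric])
  finally show ?thesis .
qed

lemma (in bounded_smc_model) integral_M:
  assumes u[measurable]: "u \<in> borel_measurable borel" and c: "\<And>x. \<bar>u x\<bar> \<le> c"
  shows "integrable \<nu> (\<lambda>x. m z x * u x)" and "(\<integral>x. m z x * u x \<partial>\<nu>) = (\<integral>x. u x \<partial>M z)"
proof -
  interpret prob_space "M z" by (rule M_prob)
  have mz: "m z \<in> borel_measurable \<nu>" and u': "u \<in> borel_measurable \<nu>"
    using measurable_compose[OF measurable_Pair1' m_meas, of z] ref_sigma_finite(2)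
    by (auto cong: measurable_cong_sets)
  have "integrable (M z) u"
    using sets_M c by (intro integrable_const_bound[where B=c]) (auto cong: measurable_cong_sets)
  then show "integrable \<nu> (\<lambda>x. m z x * u x)"
    unfolding M_density using mz u' m_nonneg by (subst (asm) integrable_real_density) auto
  show "(\<integral>x. m z x * u x \<partial>\<nu>) = (\<integral>x. u x \<partial>M z)"
    unfolding M_density using mz u' m_nonneg by (subst integral_real_density) auto
qed

text \<open>The backward indices are left out: path sums are functions of particles and weights, and
  the induction over time takes place before any backward sampling.\<close>

locale smc_run = bounded_smc_model \<chi>0 \<nu> M m g y T \<rho>0 r0 \<theta> P p Kg K\<theta> K\<omega> +
    particle_filter Pr N T \<rho>0 \<theta> P "weight_init r0 (lik g y)" "weight_step m (lik g y) \<theta> p" \<xi> I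
  for \<chi>0 \<nu> :: "'x::polish_space measure" and M m and g :: "'x \<Rightarrow> 'y::polish_space \<Rightarrow> real" and y T \<rho>0 r0 \<theta> P p
    and Kg K\<theta> K\<omega> and Pr :: "'w measure" and N \<xi> I +
  assumes N_pos: "1 \<le> N"
begin

declare One_nat_def[simp del] atMost_0[simp del]

abbreviation W :: "nat \<Rightarrow> nat \<Rightarrow> 'w \<Rightarrow> real" where
  "W \<equiv> particle_weight (weight_init r0 G) (weight_step m G \<theta> p) \<xi> I"

abbreviation Fld :: "nat \<Rightarrow> 'w measure" where "Fld \<equiv> particle_field Pr N \<xi> W"

abbreviation alive_set :: "nat \<Rightarrow> 'w set" where "alive_set \<equiv> alive Pr N W"

abbreviation paths :: "nat \<Rightarrow> (nat \<Rightarrow> nat) set" where "paths t \<equiv> {..t} \<rightarrow>\<^sub>E {1..N}"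

definition path :: "nat \<Rightarrow> (nat \<Rightarrow> nat) \<Rightarrow> 'w \<Rightarrow> nat \<Rightarrow> 'x" where
  "path t j w = (\<lambda>s\<in>{..t}. \<xi> s (j s) w)"

text \<open>
  Where the denominator vanishes the backward kernel is replaced by the uniform law, so that it is always
  a probability vector. This does not change the estimator almost surely, see \<open>law_eq\<close> below.
\<close>

definition bk :: "nat \<Rightarrow> 'w \<Rightarrow> 'x \<Rightarrow> nat \<Rightarrow> real" where
  "bk t w x i = (if (\<Sum>k=1..N. W t k w * m (\<xi> t k w) x) = 0 then 1 / real N
     else W t i w * m (\<xi> t i w) x / (\<Sum>k=1..N. W t k w * m (\<xi> t k w) x))"

text \<open>The conditional probability, under the backward chain, of the indices before time
  \<open>t\<close> given the last index \<open>j t\<close>.\<close>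

definition R :: "nat \<Rightarrow> 'w \<Rightarrow> (nat \<Rightarrow> nat) \<Rightarrow> real" where
  "R t w j = (\<Prod>s<t. bk s w (\<xi> (Suc s) (j (Suc s)) w) (j s))"

definition S :: "nat \<Rightarrow> ((nat \<Rightarrow> 'x) \<Rightarrow> real) \<Rightarrow> 'w \<Rightarrow> real" where
  "S t h w = (\<Sum>j\<in>paths t. W t (j t) w * R t w j * h (path t j w)) / real N"

text \<open>The average of \<open>h\<close> over backward paths started from a new particle at
  \<open>x\<close>. With all earlier indices summed out, the new particle enters through its
  position alone.\<close>

definition backward_mean :: "nat \<Rightarrow> ((nat \<Rightarrow> 'x) \<Rightarrow> real) \<Rightarrow> 'w \<Rightarrow> 'x \<Rightarrow> real" where
  "backward_mean t h w x = (\<Sum>j\<in>paths t. bk t w x (j t) * R t w j * h ((path t j w)(Suc t := x)))"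

lemma finite_paths: "finite (paths t)"
  by (intro finite_PiE) auto

lemma sum_paths_0: "(\<Sum>j\<in>paths 0. f j) = (\<Sum>i=1..N. f ((\<lambda>_. undefined)(0 := i)))"
proof -
  have "{..0::nat} = {0}" by auto
  then show ?thesis
    using sum_PiE_insert[of 0 "{}" "{1..N}" f] by (simp add: fun_upd_def[symmetric] del: atMost_0 fun_upd_apply)
qed

lemma sum_paths_Suc: "(\<Sum>j\<in>paths (Suc t). f j) = (\<Sum>i=1..N. \<Sum>j\<in>paths t. f (j(Suc t := i)))"
  unfolding atMost_Suc by (rule sum_PiE_insert) auto

lemma paths_mem: "j \<in> paths t \<Longrightarrow> s \<le> t \<Longrightarrow> j s \<in> {1..N}"
  using PiE_mem[of j "{..t}" "\<lambda>_. {1..N}" s] by simp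

lemma path_in_space: "path t j w \<in> space (pathspace t)"
  by (auto simp: path_def space_PiM)

lemma path_0: "path 0 j w = (\<lambda>_. undefined)(0 := \<xi> 0 (j 0) w)"
  by (auto simp: path_def restrict_def)

lemma path_last: "path t j w t = \<xi> t (j t) w"
  by (simp add: path_def)

lemma path_upd: "path (Suc t) (j(Suc t := i)) w = (path t j w)(Suc t := \<xi> (Suc t) i w)"
  by (auto simp: path_def restrict_def fun_eq_iff)

lemma R_0: "R 0 w j = 1"
  by (simp add: R_def)

lemma R_Suc: "R (Suc t) w j = R t w j * bk t w (\<xi> (Suc t) (j (Suc t)) w) (j t)"
  by (simp add: R_def)

lemma R_upd: "R t w (j(Suc t := i)) = R t w j"
  by (simp add: R_def)

section \<open>Measurability of particles, weights and the survival event\<close>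

lemma initial_measurable: "i \<in> {1..N} \<Longrightarrow> \<xi> 0 i \<in> Pr \<rightarrow>\<^sub>M borel"
  using initial_indep by (auto simp: indep_vars_def)

lemma selection_measurable:
  assumes "t \<in> {1..T}" "i \<in> {1..N}"
  shows "(\<lambda>w. (I t i w, \<xi> t i w)) \<in> Pr \<rightarrow>\<^sub>M count_space {1..N} \<Otimes>\<^sub>M borel"
  using selection_mutation[OF assms(1)] assms(2) by (auto simp: cond_iid_on_def)

lemma index_measurable:
  "t \<in> {1..T} \<Longrightarrow> i \<in> {1..N} \<Longrightarrow> I t i \<in> Pr \<rightarrow>\<^sub>M count_space {1..N}"
  using measurable_compose[OF selection_measurable measurable_fst] by simp

lemma particle_measurable:
  assumes "t \<le> T" "i \<in> {1..N}"
  shows "\<xi> t i \<in> Pr \<rightarrow>\<^sub>M borel"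
proof (cases "t = 0")
  case False
  with assms measurable_compose[OF selection_measurable measurable_snd, of t i] show ?thesis by simp
qed (use initial_measurable assms in auto)

lemma weight_init_measurable: "weight_init r0 G \<in> borel_measurable borel"
  unfolding weight_init_def[abs_def] using r0_meas by measurable

lemma weight_step_measurable:
  assumes t: "t \<in> {1..T}"
  shows "(\<lambda>(x, x'). weight_step m G \<theta> p t x x') \<in> borel_measurable (borel \<Otimes>\<^sub>M borel)"
proof -
  have [measurable]: "(\<lambda>z. m (fst z) (snd z)) \<in> borel_measurable (borel \<Otimes>\<^sub>M borel)"
      "(\<lambda>z. p t (fst z) (snd z)) \<in> borel_measurable (borel \<Otimes>\<^sub>M borel)" "\<theta> t \<in> borel_measurable borel"
    using m_meas p_meas[OF t] \<theta>_meas[OF t] by (auto simp: case_prod_beta)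
  show ?thesis unfolding weight_step_def[abs_def] case_prod_beta by measurable
qed

lemma weight_step_nonneg: "t \<in> {1..T} \<Longrightarrow> 0 \<le> weight_step m G \<theta> p t x x'"
  unfolding weight_step_def
  by (intro divide_nonneg_nonneg mult_nonneg_nonneg m_nonneg G_nonneg less_imp_le[OF \<theta>_pos] p_nonneg)

lemma W_0: "W 0 i w = weight_init r0 G (\<xi> 0 i w)"
  by (simp add: particle_weight_def)

lemma W_Suc: "W (Suc t) i w = weight_step m G \<theta> p (Suc t) (\<xi> t (I (Suc t) i w) w) (\<xi> (Suc t) i w)"
  by (simp add: particle_weight_def)

lemma W_nonneg: "t \<le> T \<Longrightarrow> 0 \<le> W t i w"
  by (cases t) (auto simp: W_0 W_Suc weight_init_def r0_nonneg G_nonneg weight_step_nonneg)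

lemma W_measurable:
  assumes "t \<le> T" and i: "i \<in> {1..N}"
  shows "W t i \<in> borel_measurable Pr"
proof (cases t)
  case 0
  then show ?thesis
    using measurable_compose[OF initial_measurable[OF i] weight_init_measurable] by (simp add: W_0[abs_def] particle_weight_def[abs_def])
next
  case (Suc u)
  have t: "t \<in> {1..T}" using assms Suc by auto
  have "(\<lambda>w. weight_step m G \<theta> p t (\<xi> u (I t i w) w) (\<xi> t i w)) \<in> borel_measurable Pr"
  \<comment> \<open>The ancestor index is itself random. It has finitely many values, and for each
    of them the weight is a measurable function of two particles.\<close>
  proof (rule measurable_compose_countable'[OF _ index_measurable[OF t i]])
    fix k assume k: "k \<in> {1..N}"
    have "(\<lambda>w. (\<xi> u k w, \<xi> t i w)) \<in> Pr \<rightarrow>\<^sub>M borel \<Otimes>\<^sub>M borel"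
      using assms Suc k by (intro measurable_Pair particle_measurable) auto
    from measurable_compose[OF this weight_step_measurable[OF t]]
    show "(\<lambda>w. weight_step m G \<theta> p t (\<xi> u k w) (\<xi> t i w)) \<in> borel_measurable Pr" by simp
  qed auto
  then show ?thesis using Suc by (simp add: particle_weight_def[abs_def])
qed

lemma generator_measurable:
  assumes "t \<le> T"
  shows "(\<lambda>w. \<lambda>(s, i)\<in>{..t} \<times> {1..N}. (\<xi> s i w, W s i w))
    \<in> Pr \<rightarrow>\<^sub>M Pi\<^sub>M ({..t} \<times> {1..N}) (\<lambda>_. borel \<Otimes>\<^sub>M borel)"
proof (rule measurable_restrict)
  fix si assume "si \<in> {..t} \<times> {1..N}"
  then show "(\<lambda>w. case si of (s, i) \<Rightarrow> (\<xi> s i w, W s i w)) \<in> Pr \<rightarrow>\<^sub>M borel \<Otimes>\<^sub>M borel"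
    using assms by (cases si) (simp add: measurable_Pair particle_measurable W_measurable)
qed

lemma subalgebra_Fld: "t \<le> T \<Longrightarrow> subalgebra Pr (Fld t)"
  unfolding subalgebra_def particle_field_def
  using sets_image_in_sets[OF refl generator_measurable] by simp

lemma space_Fld: "space (Fld t) = space Pr"
  by (simp add: particle_field_def)

lemma pair_Fld_measurable:
  assumes "s \<le> t" "i \<in> {1..N}"
  shows "(\<lambda>w. (\<xi> s i w, W s i w)) \<in> Fld t \<rightarrow>\<^sub>M borel \<Otimes>\<^sub>M borel"
proof -
  let ?gen = "\<lambda>w. \<lambda>(s, i)\<in>{..t} \<times> {1..N}. (\<xi> s i w, W s i w)"
  let ?M = "Pi\<^sub>M ({..t} \<times> {1..N}) (\<lambda>_. borel \<Otimes>\<^sub>M borel) :: (nat \<times> nat \<Rightarrow> 'x \<times> real) measure"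
  have "?gen \<in> Fld t \<rightarrow>\<^sub>M ?M"
    unfolding particle_field_def by (rule measurable_vimage_algebra1) (auto simp: space_PiM space_pair_measure)
  then have "(\<lambda>w. ?gen w (s, i)) \<in> Fld t \<rightarrow>\<^sub>M borel \<Otimes>\<^sub>M borel"
    by (rule measurable_compose) (use assms in auto)
  then show ?thesis using assms by simp
qed

lemma particle_Fld_measurable:
  assumes "s \<le> t" "i \<in> {1..N}"
  shows "\<xi> s i \<in> Fld t \<rightarrow>\<^sub>M borel"
  using measurable_compose[OF pair_Fld_measurable[OF assms] measurable_fst] by (simp only: fst_conv)

text \<open>The weights are generators of \<open>Fld\<close> in their own right. They also depend on
  ancestor indices, which need not be measurable with respect to \<open>Fld\<close>.\<close>

lemma W_Fld_measurable:
  assumes "s \<le> t" "i \<in> {1..N}"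
  shows "W s i \<in> borel_measurable (Fld t)"
  using measurable_compose[OF pair_Fld_measurable[OF assms] measurable_snd] by (simp only: snd_conv)

lemma alive_in_Fld: "alive_set t \<in> sets (Fld t)"
proof -
  have sum: "(\<lambda>w. \<Sum>i=1..N. W s i w) \<in> borel_measurable (Fld t)" if "s \<in> {..t}" for s
  proof (rule borel_measurable_sum)
    fix i assume "i \<in> {1..N}"
    with that show "W s i \<in> borel_measurable (Fld t)" by (intro W_Fld_measurable) simp_all
  qed
  have "{w \<in> space (Fld t). \<forall>s\<in>{..t}. 0 < (\<Sum>i=1..N. W s i w)} \<in> sets (Fld t)"
  proof (rule sets.sets_Collect_finite_All)
    show "{w \<in> space (Fld t). 0 < (\<Sum>i=1..N. W s i w)} \<in> sets (Fld t)" if "s \<in> {..t}" for s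
      by (rule borel_measurable_less[OF borel_measurable_const sum[OF that]])
  qed simp
  then show ?thesis by (simp only: alive_def space_Fld Ball_def atMost_iff)
qed

lemma alive_subset: "alive_set t \<subseteq> space Pr"
  by (auto simp: alive_def)

lemma alive_Suc: "w \<in> alive_set (Suc t) \<longleftrightarrow> w \<in> alive_set t \<and> 0 < (\<Sum>i=1..N. W (Suc t) i w)"
  by (auto simp: alive_def le_Suc_eq)

section \<open>Backward probabilities and their path sums\<close>

lemma bk_nonneg: "t \<le> T \<Longrightarrow> 0 \<le> bk t w x i"
  unfolding bk_def by (auto intro!: divide_nonneg_nonneg mult_nonneg_nonneg W_nonneg sum_nonneg m_nonneg)

lemma bk_sum: "(\<Sum>i=1..N. bk t w x i) = 1"
proof (cases "(\<Sum>k=1..N. W t k w * m (\<xi> t k w) x) = 0")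
  case True
  then show ?thesis using N_pos by (simp add: bk_def)
next
  case False
  then show ?thesis by (simp add: bk_def sum_divide_distrib[symmetric])
qed

text \<open>If the denominator is 0, each of its nonnegative summands is 0, so the identity survives
  the replacement by the uniform law.\<close>

lemma bk_numerator:
  assumes "t \<le> T" "i \<in> {1..N}"
  shows "(\<Sum>k=1..N. W t k w * m (\<xi> t k w) x) * bk t w x i = W t i w * m (\<xi> t i w) x"
proof (cases "(\<Sum>k=1..N. W t k w * m (\<xi> t k w) x) = 0")
  case True
  then have "\<forall>k\<in>{1..N}. W t k w * m (\<xi> t k w) x = 0"
    using assms by (subst (asm) sum_nonneg_eq_0_iff) (auto intro!: mult_nonneg_nonneg W_nonneg m_nonneg)
  then show ?thesis using True assms by simp
qed (simp add: bk_def)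

lemma R_nonneg: "t \<le> T \<Longrightarrow> 0 \<le> R t w j"
  unfolding R_def by (intro prod_nonneg bk_nonneg) auto

text \<open>Backward probabilities add up to 1. In the induction, summing out the indices up to
  \<open>t\<close> for a fixed last index uses the hypothesis with a backward probability in place
  of \<open>a\<close>, hence the arbitrary \<open>a\<close>.\<close>

lemma sum_R: "(\<Sum>j\<in>paths t. a (j t) * R t w j) = (\<Sum>i=1..N. a i)"
proof (induction t arbitrary: a)
  case 0
  show ?case by (simp add: sum_paths_0 R_0)
next
  case (Suc t)
  have "(\<Sum>j\<in>paths (Suc t). a (j (Suc t)) * R (Suc t) w j) =
      (\<Sum>i=1..N. a i * (\<Sum>j\<in>paths t. bk t w (\<xi> (Suc t) i w) (j t) * R t w j))"
    by (simp add: sum_paths_Suc R_Suc R_upd sum_distrib_left mult_ac)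
  then show ?case unfolding Suc by (simp add: bk_sum)
qed

text \<open>By \<open>sum_R\<close> with the weights as \<open>a\<close>. Survival of the weights
  thus becomes positivity of a path sum, which the deviation bounds can control.\<close>

lemma S_1: "S t (\<lambda>_. 1) w = (\<Sum>i=1..N. W t i w) / real N"
  using sum_R[of "\<lambda>i. W t i w" t w] by (simp add: S_def)

lemma S_bound:
  assumes t: "t \<le> T" and c: "\<And>x. x \<in> space (pathspace t) \<Longrightarrow> \<bar>h x\<bar> \<le> c"
  shows "\<bar>S t h w\<bar> \<le> c * S t (\<lambda>_. 1) w"
proof -
  have "\<bar>\<Sum>j\<in>paths t. W t (j t) w * R t w j * h (path t j w)\<bar> \<le> (\<Sum>j\<in>paths t. W t (j t) w * R t w j * c)"
    using t c[OF path_in_space]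
    by (intro order.trans[OF sum_abs] sum_mono)
       (auto simp: abs_mult W_nonneg R_nonneg intro!: mult_left_mono mult_nonneg_nonneg)
  then show ?thesis
    by (simp add: S_def sum_distrib_left[symmetric] sum_distrib_right[symmetric] divide_right_mono mult.commute)
qed

text \<open>A convex combination of values of \<open>h\<close>, so the bound does not grow with the
  number of paths.\<close>

lemma backward_mean_bound:
  assumes t: "Suc t \<le> T" and c: "\<And>x. x \<in> space (pathspace (Suc t)) \<Longrightarrow> \<bar>h x\<bar> \<le> c"
  shows "\<bar>backward_mean t h w x\<bar> \<le> c"
proof -
  have "\<bar>backward_mean t h w x\<bar> \<le> (\<Sum>j\<in>paths t. bk t w x (j t) * R t w j * c)"
    unfolding backward_mean_def using t c[OF path_upd_in_space[OF path_in_space]]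
    by (intro order.trans[OF sum_abs] sum_mono)
       (auto simp: abs_mult bk_nonneg R_nonneg intro!: mult_left_mono mult_nonneg_nonneg)
  also have "\<dots> = c"
    using sum_R[of "bk t w x" t w] by (simp add: sum_distrib_right[symmetric] bk_sum)
  finally show ?thesis .
qed

lemma S_Suc:
  "S (Suc t) h w = (\<Sum>i=1..N. weight_step m G \<theta> p (Suc t) (\<xi> t (I (Suc t) i w) w) (\<xi> (Suc t) i w) *
     backward_mean t h w (\<xi> (Suc t) i w)) / real N"
  unfolding S_def sum_paths_Suc W_Suc[symmetric] backward_mean_def
  by (simp add: R_Suc R_upd path_upd sum_distrib_left mult_ac)

lemma bk_measurable:
  assumes "s \<le> t" "i \<in> {1..N}"
  shows "(\<lambda>(w, x). bk s w x i) \<in> borel_measurable (Fld t \<Otimes>\<^sub>M borel)"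
proof -
  have [measurable]: "\<xi> s k \<in> Fld t \<rightarrow>\<^sub>M borel" if "k \<in> {1..N}" for k
    using assms that by (auto intro!: particle_Fld_measurable)
  have Wk: "(\<lambda>z. W s k (fst z)) \<in> borel_measurable (Fld t \<Otimes>\<^sub>M borel)" if "k \<in> {1..N}" for k
    using assms that by (intro measurable_compose[OF measurable_fst] W_Fld_measurable)
  have mk: "(\<lambda>z. m (\<xi> s k (fst z)) (snd z)) \<in> borel_measurable (Fld t \<Otimes>\<^sub>M borel)" if "k \<in> {1..N}" for k
  proof -
    have "(\<lambda>z. (\<xi> s k (fst z), snd z)) \<in> Fld t \<Otimes>\<^sub>M borel \<rightarrow>\<^sub>M borel \<Otimes>\<^sub>M borel"
      using that by measurable
    from measurable_compose[OF this m_meas] show ?thesis by simp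
  qed
  have sum: "(\<lambda>z. \<Sum>k=1..N. W s k (fst z) * m (\<xi> s k (fst z)) (snd z)) \<in> borel_measurable (Fld t \<Otimes>\<^sub>M borel)"
    by (intro borel_measurable_sum borel_measurable_times mk Wk)
  show ?thesis unfolding bk_def case_prod_beta
    by (intro measurable_If borel_measurable_divide borel_measurable_times borel_measurable_eq
      sum mk Wk measurable_const assms(2)) auto
qed

lemma R_measurable:
  assumes "s \<le> t" "j \<in> paths s"
  shows "(\<lambda>w. R s w j) \<in> borel_measurable (Fld t)"
  unfolding R_def
proof (rule borel_measurable_prod)
  fix u assume u: "u \<in> {..<s}"
  have "(\<lambda>w. (w, \<xi> (Suc u) (j (Suc u)) w)) \<in> Fld t \<rightarrow>\<^sub>M Fld t \<Otimes>\<^sub>M borel"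
    using assms u paths_mem[OF assms(2), of "Suc u"] by (intro measurable_Pair measurable_ident particle_Fld_measurable) simp_all
  from measurable_compose[OF this bk_measurable[of u t "j u"]] paths_mem[OF assms(2), of u] assms(1) u
  show "(\<lambda>w. bk u w (\<xi> (Suc u) (j (Suc u)) w) (j u)) \<in> borel_measurable (Fld t)"
    by simp
qed

lemma path_measurable:
  assumes "s \<le> t" "j \<in> paths s"
  shows "path s j \<in> Fld t \<rightarrow>\<^sub>M pathspace s"
  unfolding path_def[abs_def] using assms by (intro measurable_restrict particle_Fld_measurable) auto

lemma S_measurable:
  assumes "s \<le> t" and h: "h \<in> bounded_measurable s"
  shows "S s h \<in> borel_measurable (Fld t)"
proof -
  show ?thesis unfolding S_def[abs_def] using assms
    by (intro borel_measurable_divide borel_measurable_sum borel_measurable_times borel_measurable_const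
      W_Fld_measurable R_measurable measurable_compose[OF path_measurable bounded_measurableD(1)[OF h]]) auto
qed

lemma backward_mean_measurable:
  assumes h: "h \<in> bounded_measurable (Suc t)"
  shows "(\<lambda>(w, x). backward_mean t h w x) \<in> borel_measurable (Fld t \<Otimes>\<^sub>M borel)"
  unfolding backward_mean_def case_prod_beta
proof (intro borel_measurable_sum borel_measurable_times)
  fix j assume j: "j \<in> paths t"
  then show "(\<lambda>z. bk t (fst z) (snd z) (j t)) \<in> borel_measurable (Fld t \<Otimes>\<^sub>M borel)"
    using bk_measurable[of t t "j t"] paths_mem[OF j] by (simp add: case_prod_beta)
  show "(\<lambda>z. R t (fst z) j) \<in> borel_measurable (Fld t \<Otimes>\<^sub>M borel)"
    using R_measurable[OF order.refl j] by measurable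
  have "(\<lambda>z. (path t j (fst z), snd z)) \<in> Fld t \<Otimes>\<^sub>M borel \<rightarrow>\<^sub>M pathspace t \<Otimes>\<^sub>M borel"
    using path_measurable[OF order.refl j] by measurable
  from measurable_compose[OF measurable_compose[OF this path_upd_measurable] bounded_measurableD(1)[OF h]]
  show "(\<lambda>z. h ((path t j (fst z))(Suc t := snd z))) \<in> borel_measurable (Fld t \<Otimes>\<^sub>M borel)"
    by simp
qed

text \<open>
  The mixture of the transition kernels turns the backward probabilities into forward weights: the
  denominator of the backward kernel is the density of the mixture.
\<close>

lemma sum_M_backward_mean:
  assumes t: "Suc t \<le> T" and h: "h \<in> bounded_measurable (Suc t)" and w: "w \<in> space Pr"
  shows "(\<Sum>k=1..N. W t k w * (\<integral>x. m (\<xi> t k w) x * (G (Suc t) x * backward_mean t h w x) \<partial>\<nu>)) = real N * S t (L t h) w"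
proof -
  obtain c where c: "\<And>x. x \<in> space (pathspace (Suc t)) \<Longrightarrow> \<bar>h x\<bar> \<le> c"
    using bounded_measurableD(2)[OF h] by auto
  have Gb: "\<bar>G (Suc t) x * a\<bar> \<le> Kg * c" if "\<bar>a\<bar> \<le> c" for x a
    using lik_le[OF t, of x] G_nonneg[of "Suc t" x] K_pos that by (auto simp: abs_mult intro!: mult_mono)
  have bm[measurable]: "backward_mean t h w \<in> borel_measurable borel"
    using measurable_compose[OF measurable_Pair1' backward_mean_measurable[OF h], of w] w by (simp add: space_Fld)
  have int1: "integrable \<nu> (\<lambda>x. m z x * (G (Suc t) x * backward_mean t h w x))" for z
    by (rule integral_M(1)[where c="Kg * c"]) (auto intro!: Gb backward_mean_bound[OF t c])
  have hm[measurable]: "(\<lambda>x. h ((path t j w)(Suc t := x))) \<in> borel_measurable borel" for j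
    using measurable_compose[OF measurable_compose[OF measurable_Pair1'[OF path_in_space] path_upd_measurable] bounded_measurableD(1)[OF h]]
    by simp
  have int2: "integrable \<nu> (\<lambda>x. m z x * (G (Suc t) x * h ((path t j w)(Suc t := x))))"
    and val2: "(\<integral>x. m z x * (G (Suc t) x * h ((path t j w)(Suc t := x))) \<partial>\<nu>) =
      (\<integral>x. G (Suc t) x * h ((path t j w)(Suc t := x)) \<partial>M z)" for z j
    by (rule integral_M[where c="Kg * c"]; auto intro!: Gb c path_upd_in_space path_in_space)+
  have "(\<Sum>k=1..N. W t k w * (\<integral>x. m (\<xi> t k w) x * (G (Suc t) x * backward_mean t h w x) \<partial>\<nu>)) =
      (\<integral>x. (\<Sum>k=1..N. W t k w * (m (\<xi> t k w) x * (G (Suc t) x * backward_mean t h w x))) \<partial>\<nu>)"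
    using int1 by simp
  also have "\<dots> = (\<integral>x. (\<Sum>j\<in>paths t. W t (j t) w * R t w j *
      (m (\<xi> t (j t) w) x * (G (Suc t) x * h ((path t j w)(Suc t := x))))) \<partial>\<nu>)"
  proof (intro Bochner_Integration.integral_cong refl)
    fix x
    let ?d = "\<Sum>k=1..N. W t k w * m (\<xi> t k w) x"
    have "(\<Sum>k=1..N. W t k w * (m (\<xi> t k w) x * (G (Suc t) x * backward_mean t h w x))) =
        ?d * (G (Suc t) x * backward_mean t h w x)"
      unfolding sum_distrib_right by (simp only: mult.assoc)
    also have "\<dots> = (\<Sum>j\<in>paths t. (?d * bk t w x (j t)) * (R t w j * (G (Suc t) x * h ((path t j w)(Suc t := x)))))"
      unfolding backward_mean_def sum_distrib_left by (simp add: mult_ac)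
    also have "\<dots> = (\<Sum>j\<in>paths t. W t (j t) w * R t w j *
      (m (\<xi> t (j t) w) x * (G (Suc t) x * h ((path t j w)(Suc t := x)))))"
    \<comment> \<open>\<open>bk_numerator\<close> cancels the mixture density \<open>?d\<close>,
      also at those \<open>x\<close> where it vanishes.\<close>
    proof (rule sum.cong[OF refl])
      fix j assume "j \<in> paths t"
      then have "j t \<in> {1..N}" by (rule paths_mem) simp
      from bk_numerator[OF _ this, of t w x] t
      show "(?d * bk t w x (j t)) * (R t w j * (G (Suc t) x * h ((path t j w)(Suc t := x)))) =
        W t (j t) w * R t w j * (m (\<xi> t (j t) w) x * (G (Suc t) x * h ((path t j w)(Suc t := x))))"
        by (simp add: mult_ac)
    qed
    finally show "(\<Sum>k=1..N. W t k w * (m (\<xi> t k w) x * (G (Suc t) x * backward_mean t h w x))) =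
      (\<Sum>j\<in>paths t. W t (j t) w * R t w j * (m (\<xi> t (j t) w) x * (G (Suc t) x * h ((path t j w)(Suc t := x)))))" .
  qed
  also have "\<dots> = (\<Sum>j\<in>paths t. W t (j t) w * R t w j * L t h (path t j w))"
    using int2 by (simp add: val2 transition_def path_last)
  also have "\<dots> = real N * S t (L t h) w"
    using N_pos by (simp add: S_def)
  finally show ?thesis .
qed

end

section \<open>One step of the particle filter\<close>

text \<open>For probabilities \<open>q\<close> and probability densities \<open>r j\<close>, the law
  of a pair obtained by drawing an index \<open>j\<close> with probability \<open>q j\<close> and
  then a state with density \<open>r j\<close>. As a density over a product measure it reduces
  integrals to Fubini's theorem.\<close>

definition mixture :: "'i set \<Rightarrow> 'x measure \<Rightarrow> ('i \<Rightarrow> real) \<Rightarrow> ('i \<Rightarrow> 'x \<Rightarrow> real) \<Rightarrow> ('i \<times> 'x) measure" where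
  "mixture K \<nu> q r = density (count_space K \<Otimes>\<^sub>M \<nu>) (\<lambda>z. ennreal (q (fst z) * r (fst z) (snd z)))"

lemma sets_mixture: "sets (mixture K \<nu> q r) = sets (count_space K \<Otimes>\<^sub>M \<nu>)"
  by (simp add: mixture_def)

lemma
  fixes f :: "'i \<times> 'x \<Rightarrow> real"
  assumes K: "finite K" and \<nu>: "sigma_finite_measure \<nu>"
    and q: "\<And>j. j \<in> K \<Longrightarrow> 0 \<le> q j"
    and r: "\<And>j. j \<in> K \<Longrightarrow> r j \<in> borel_measurable \<nu>" "\<And>j x. j \<in> K \<Longrightarrow> 0 \<le> r j x"
  shows emeasure_mixture: "A \<in> sets (count_space K \<Otimes>\<^sub>M \<nu>) \<Longrightarrow>
      emeasure (mixture K \<nu> q r) A = (\<Sum>j\<in>K. ennreal (q j) * emeasure (density \<nu> (\<lambda>x. ennreal (r j x))) (Pair j -` A))"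
    and integral_mixture: "integrable (mixture K \<nu> q r) f \<Longrightarrow>
      (\<integral>z. f z \<partial>mixture K \<nu> q r) = (\<Sum>j\<in>K. \<integral>x. q j * r j x * f (j, x) \<partial>\<nu>)"
proof -
  interpret \<nu>: sigma_finite_measure \<nu> by fact
  interpret C: sigma_finite_measure "count_space K" by (rule sigma_finite_measure_count_space_finite[OF K])
  interpret pair_sigma_finite "count_space K" \<nu> ..
  have dens[measurable]: "(\<lambda>z. q (fst z) * r (fst z) (snd z)) \<in> borel_measurable (count_space K \<Otimes>\<^sub>M \<nu>)"
    by (rule measurable_pair_measure_countable1) (use K r in \<open>auto intro: countable_finite\<close>)
  show "emeasure (mixture K \<nu> q r) A = (\<Sum>j\<in>K. ennreal (q j) * emeasure (density \<nu> (\<lambda>x. ennreal (r j x))) (Pair j -` A))"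
    if A[measurable]: "A \<in> sets (count_space K \<Otimes>\<^sub>M \<nu>)"
  proof -
    have "emeasure (mixture K \<nu> q r) A =
        (\<integral>\<^sup>+z. ennreal (q (fst z) * r (fst z) (snd z)) * indicator A z \<partial>(count_space K \<Otimes>\<^sub>M \<nu>))"
      unfolding mixture_def by (rule emeasure_density) auto
    also have "\<dots> = (\<integral>\<^sup>+j. \<integral>\<^sup>+x. ennreal (q j * r j x) * indicator A (j, x) \<partial>\<nu> \<partial>count_space K)"
      by (subst \<nu>.nn_integral_fst[symmetric]) auto
    also have "\<dots> = (\<Sum>j\<in>K. \<integral>\<^sup>+x. ennreal (q j * r j x) * indicator A (j, x) \<partial>\<nu>)"
      by (rule nn_integral_count_space_finite[OF K])
    also have "\<dots> = (\<Sum>j\<in>K. ennreal (q j) * emeasure (density \<nu> (\<lambda>x. ennreal (r j x))) (Pair j -` A))"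
    proof (rule sum.cong[OF refl])
      fix j assume j: "j \<in> K"
      note [measurable] = r(1)[OF j] sets_Pair1[OF A]
      have "(\<integral>\<^sup>+x. ennreal (q j * r j x) * indicator A (j, x) \<partial>\<nu>) =
          (\<integral>\<^sup>+x. ennreal (q j) * (ennreal (r j x) * indicator (Pair j -` A) x) \<partial>\<nu>)"
        by (intro nn_integral_cong) (auto simp: indicator_def ennreal_mult q[OF j] r(2)[OF j])
      also have "\<dots> = ennreal (q j) * (\<integral>\<^sup>+x. ennreal (r j x) * indicator (Pair j -` A) x \<partial>\<nu>)"
        by (rule nn_integral_cmult) measurable
      finally show "(\<integral>\<^sup>+x. ennreal (q j * r j x) * indicator A (j, x) \<partial>\<nu>) =
          ennreal (q j) * emeasure (density \<nu> (\<lambda>x. ennreal (r j x))) (Pair j -` A)"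
        by (simp add: emeasure_density)
    qed
    finally show ?thesis .
  qed
  show "(\<integral>z. f z \<partial>mixture K \<nu> q r) = (\<Sum>j\<in>K. \<integral>x. q j * r j x * f (j, x) \<partial>\<nu>)"
    if int: "integrable (mixture K \<nu> q r) f"
  proof -
    have f[measurable]: "f \<in> borel_measurable (count_space K \<Otimes>\<^sub>M \<nu>)"
      using borel_measurable_integrable[OF int] by (simp add: mixture_def cong: measurable_cong_sets)
    have pos: "AE z in count_space K \<Otimes>\<^sub>M \<nu>. 0 \<le> q (fst z) * r (fst z) (snd z)"
      by (rule AE_I2) (auto simp: space_pair_measure q r)
    have "(\<integral>z. f z \<partial>mixture K \<nu> q r) = (\<integral>z. q (fst z) * r (fst z) (snd z) * f z \<partial>(count_space K \<Otimes>\<^sub>M \<nu>))"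
      unfolding mixture_def by (rule integral_real_density[OF dens pos f])
    also have "\<dots> = (\<integral>j. \<integral>x. q j * r j x * f (j, x) \<partial>\<nu> \<partial>count_space K)"
    proof (subst integral_fst'[symmetric])
      show "integrable (count_space K \<Otimes>\<^sub>M \<nu>) (\<lambda>z. q (fst z) * r (fst z) (snd z) * f z)"
        using int unfolding mixture_def integrable_real_density[OF dens pos f] .
    qed simp
    also have "\<dots> = (\<Sum>j\<in>K. \<integral>x. q j * r j x * f (j, x) \<partial>\<nu>)"
      by (rule lebesgue_integral_count_space_finite[OF K])
    finally show ?thesis .
  qed
qed

text \<open>The difference equals \<open>((a - a') + (a / b) * (b' - b)) / b'\<close>. Only
  \<open>b'\<close> is left in the denominator, so a lower bound is needed just for the denominator
  cast as \<open>b'\<close>.\<close>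

lemma abs_ratio_diff_le:
  fixes a b a' b' c :: real
  assumes "0 < b" "0 < b'" "\<bar>a\<bar> \<le> c * b"
  shows "\<bar>a / b - a' / b'\<bar> \<le> (\<bar>a - a'\<bar> + c * \<bar>b - b'\<bar>) / b'"
proof -
  have "a / b - a' / b' = ((a - a') + (a / b) * (b' - b)) / b'"
    using assms by (simp add: field_simps)
  moreover have "\<bar>a / b\<bar> \<le> c"
    using assms by (simp add: field_simps abs_le_iff)
  then have "\<bar>(a / b) * (b' - b)\<bar> \<le> c * \<bar>b - b'\<bar>"
    unfolding abs_mult abs_minus_commute[of b'] by (intro mult_right_mono) auto
  ultimately show ?thesis
    using assms(2) abs_triangle_ineq[of "a - a'" "(a / b) * (b' - b)"]
    by (simp only: abs_divide) (intro frac_le, linarith+)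
qed

section \<open>The conditional law of a new generation and Hoeffding's inequality for it\<close>

context smc_run
begin

text \<open>The D_t of the overview is \<open>normalizer t w / real N\<close>.\<close>

definition normalizer :: "nat \<Rightarrow> 'w \<Rightarrow> real" where
  "normalizer t w = (\<Sum>j=1..N. W t j w * \<theta> (Suc t) (\<xi> t j w))"

text \<open>\<open>selection_mutation_law\<close> as a genuine measure. It has total mass 1 on
  \<open>alive_set t\<close>; where the normalizer is 0, division by zero makes it the null
  measure.\<close>

definition step_law :: "nat \<Rightarrow> 'w \<Rightarrow> (nat \<times> 'x) measure" where
  "step_law t w = mixture {1..N} \<nu> (\<lambda>j. W t j w * \<theta> (Suc t) (\<xi> t j w) / normalizer t w) (\<lambda>j. p (Suc t) (\<xi> t j w))"

lemma normalizer_nonneg: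
  assumes "Suc t \<le> T"
  shows "0 \<le> normalizer t w"
  unfolding normalizer_def using assms
  by (intro sum_nonneg mult_nonneg_nonneg W_nonneg less_imp_le[OF \<theta>_pos]) auto

lemma normalizer_pos:
  assumes t: "Suc t \<le> T" and w: "w \<in> alive_set t"
  shows "0 < normalizer t w"
proof -
  have pos: "0 < (\<Sum>i=1..N. W t i w)" using w by (simp add: alive_def)
  have "\<exists>i\<in>{1..N}. 0 < W t i w"
  proof (rule ccontr)
    assume "\<not> ?thesis"
    then have "(\<Sum>i=1..N. W t i w) \<le> 0" by (intro sum_nonpos) (auto simp: not_less)
    with pos show False by simp
  qed
  then obtain i where i: "i \<in> {1..N}" "0 < W t i w" by auto
  have "0 < W t i w * \<theta> (Suc t) (\<xi> t i w)" using i t by (intro mult_pos_pos \<theta>_pos) auto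
  also have "\<dots> \<le> normalizer t w" unfolding normalizer_def using i t
    by (intro member_le_sum mult_nonneg_nonneg W_nonneg less_imp_le[OF \<theta>_pos]) auto
  finally show ?thesis .
qed

text \<open>In \<open>deviation\<close> this becomes a lower bound for the predicted total mass,
  which has the normalizer in its denominator.\<close>

lemma normalizer_le:
  assumes "Suc t \<le> T"
  shows "normalizer t w \<le> K\<theta> * (\<Sum>i=1..N. W t i w)"
  unfolding normalizer_def sum_distrib_left mult.commute[of K\<theta>] using assms
  by (intro sum_mono mult_left_mono \<theta>_le W_nonneg) auto

lemma step_weight_nonneg:
  assumes "Suc t \<le> T" "j \<in> {1..N}"
  shows "0 \<le> W t j w * \<theta> (Suc t) (\<xi> t j w) / normalizer t w"
  using assms by (intro divide_nonneg_nonneg mult_nonneg_nonneg W_nonneg less_imp_le[OF \<theta>_pos] normalizer_nonneg) auto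

lemma p_measurable:
  assumes "t \<in> {1..T}"
  shows "p t z \<in> borel_measurable \<nu>"
  using measurable_compose[OF measurable_Pair1' p_meas[OF assms], of z] ref_sigma_finite(2)
  by (simp cong: measurable_cong_sets)

lemma P_prob:
  assumes "t \<in> {1..T}"
  shows "prob_space (P t z)"
  using measurable_space[OF P_kernel[OF assms], of z] by (simp add: space_prob_algebra)

lemma sets_step_law: "sets (step_law t w) = sets (count_space {1..N} \<Otimes>\<^sub>M borel)"
  unfolding step_law_def sets_mixture by (intro sets_pair_measure_cong refl ref_sigma_finite)

lemma emeasure_step_law:
  assumes t: "Suc t \<le> T" and A: "A \<in> sets (count_space {1..N} \<Otimes>\<^sub>M borel)"
  shows "emeasure (step_law t w) A = ennreal (selection_mutation_law N \<theta> P \<xi> W (Suc t) w A)"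
proof -
  have t': "Suc t \<in> {1..T}" using t by auto
  have A': "A \<in> sets (count_space {1..N} \<Otimes>\<^sub>M \<nu>)"
    using A sets_step_law[of t w] unfolding step_law_def sets_mixture by simp
  have Pz: "emeasure (P (Suc t) z) B = ennreal (measure (P (Suc t) z) B)" for z B
    using P_prob[OF t', of z] by (simp add: finite_measure.emeasure_eq_measure prob_space.finite_measure)
  let ?q = "\<lambda>j. W t j w * \<theta> (Suc t) (\<xi> t j w) / normalizer t w"
  have "emeasure (step_law t w) A = (\<Sum>j=1..N. ennreal (?q j) * emeasure (P (Suc t) (\<xi> t j w)) (Pair j -` A))"
    unfolding step_law_def P_density[OF t']
    by (rule emeasure_mixture[OF _ ref_sigma_finite(1) step_weight_nonneg p_measurable p_nonneg A']) (use t t' in auto)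
  also have "\<dots> = (\<Sum>j=1..N. ennreal (?q j * measure (P (Suc t) (\<xi> t j w)) (Pair j -` A)))"
    unfolding Pz by (intro sum.cong refl ennreal_mult[symmetric] step_weight_nonneg[OF t] measure_nonneg)
  also have "\<dots> = ennreal (\<Sum>j=1..N. ?q j * measure (P (Suc t) (\<xi> t j w)) (Pair j -` A))"
    by (intro sum_ennreal mult_nonneg_nonneg step_weight_nonneg[OF t] measure_nonneg)
  also have "(\<Sum>j=1..N. ?q j * measure (P (Suc t) (\<xi> t j w)) (Pair j -` A)) =
      selection_mutation_law N \<theta> P \<xi> W (Suc t) w A"
    unfolding selection_mutation_law_def diff_Suc_1 normalizer_def[symmetric] vimage_def
    by (simp add: sum_divide_distrib)
  finally show ?thesis .
qed

lemma selection_mutation_law_nonneg: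
  assumes t: "Suc t \<le> T"
  shows "0 \<le> selection_mutation_law N \<theta> P \<xi> W (Suc t) w A"
  unfolding selection_mutation_law_def diff_Suc_1 normalizer_def[symmetric] using t
  by (intro divide_nonneg_nonneg sum_nonneg mult_nonneg_nonneg W_nonneg less_imp_le[OF \<theta>_pos] normalizer_nonneg) auto

lemma measure_step_law:
  assumes t: "Suc t \<le> T" and A: "A \<in> sets (count_space {1..N} \<Otimes>\<^sub>M borel)"
  shows "measure (step_law t w) A = selection_mutation_law N \<theta> P \<xi> W (Suc t) w A"
  unfolding measure_def emeasure_step_law[OF assms] by (simp add: selection_mutation_law_nonneg[OF t])

lemma prob_space_step_law:
  assumes t: "Suc t \<le> T" and w: "w \<in> alive_set t"
  shows "prob_space (step_law t w)"
proof
  have t': "Suc t \<in> {1..T}" using t by auto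
  have sp: "space (step_law t w) = {1..N} \<times> UNIV"
    using sets_eq_imp_space_eq[OF sets_step_law[of t w]] by (simp add: space_pair_measure)
  have P1: "measure (P (Suc t) z) UNIV = 1" for z
    using prob_space.prob_space[OF P_prob[OF t', of z]] measurable_space[OF P_kernel[OF t'], of z]
    by (auto simp: space_prob_algebra dest: sets_eq_imp_space_eq)
  have "selection_mutation_law N \<theta> P \<xi> W (Suc t) w ({1..N} \<times> UNIV) = normalizer t w / normalizer t w"
    unfolding selection_mutation_law_def diff_Suc_1 normalizer_def[symmetric]
    by (simp add: P1 normalizer_def)
  also have "\<dots> = 1" using normalizer_pos[OF t w] by simp
  finally show "emeasure (step_law t w) (space (step_law t w)) = 1"
    unfolding sp by (subst emeasure_step_law[OF t]) auto
qed

lemma measure_step_law_measurable: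
  assumes t: "Suc t \<le> T" and A: "A \<in> sets (count_space {1..N} \<Otimes>\<^sub>M borel)"
  shows "(\<lambda>w. measure (step_law t w) A) \<in> borel_measurable (Fld t)"
  unfolding measure_step_law[OF assms] selection_mutation_law_def diff_Suc_1
proof (intro borel_measurable_divide borel_measurable_sum borel_measurable_times)
  fix j assume j: "j \<in> {1..N}"
  have t': "Suc t \<in> {1..T}" using t by auto
  show "W t j \<in> borel_measurable (Fld t)" by (rule W_Fld_measurable[OF order.refl j])
  note \<xi>m = particle_Fld_measurable[OF order.refl j]
  show "(\<lambda>w. \<theta> (Suc t) (\<xi> t j w)) \<in> borel_measurable (Fld t)"
    by (rule measurable_compose[OF \<xi>m \<theta>_meas[OF t']])
  then show "(\<lambda>w. \<theta> (Suc t) (\<xi> t j w)) \<in> borel_measurable (Fld t)" .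
  have "{x. (j, x) \<in> A} \<in> sets borel"
    using sets_Pair1[OF A, of j] by (simp add: vimage_def)
  then have "(\<lambda>z. measure (P (Suc t) z) {x. (j, x) \<in> A}) \<in> borel_measurable borel"
    by (intro measure_measurable_subprob_algebra2[OF _ measurable_prob_algebraD[OF P_kernel[OF t']]])
      (auto intro!: pair_measureI)
  from measurable_compose[OF \<xi>m this]
  show "(\<lambda>w. measure (P (Suc t) (\<xi> t j w)) {x. (j, x) \<in> A}) \<in> borel_measurable (Fld t)" .
qed (rule W_Fld_measurable[OF order.refl]; assumption)

definition increment :: "nat \<Rightarrow> ((nat \<Rightarrow> 'x) \<Rightarrow> real) \<Rightarrow> 'w \<Rightarrow> nat \<times> 'x \<Rightarrow> real" where
  "increment t h w z = weight_step m G \<theta> p (Suc t) (\<xi> t (fst z) w) (snd z) * backward_mean t h w (snd z)"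

lemma S_Suc_increment: "S (Suc t) h w = (\<Sum>i=1..N. increment t h w (I (Suc t) i w, \<xi> (Suc t) i w)) / real (card {1..N})"
  by (simp add: S_Suc increment_def)

lemma increment_measurable:
  assumes t: "Suc t \<le> T" and h: "h \<in> bounded_measurable (Suc t)"
  shows "(\<lambda>(w, z). increment t h w z) \<in> borel_measurable (Fld t \<Otimes>\<^sub>M (count_space {1..N} \<Otimes>\<^sub>M borel))"
proof -
  let ?M = "Fld t \<Otimes>\<^sub>M (count_space {1..N} \<Otimes>\<^sub>M (borel :: 'x measure))"
  have "(\<lambda>a. weight_step m G \<theta> p (Suc t) (\<xi> t (fst (snd a)) (fst a)) (snd (snd a))) \<in> borel_measurable ?M"
  proof (rule measurable_compose_countable'[where I="{1..N}" and g="\<lambda>a. fst (snd a)"])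
    fix k assume k: "k \<in> {1..N}"
    note [measurable] = particle_Fld_measurable[OF order.refl k]
    have "(\<lambda>a. (\<xi> t k (fst a), snd (snd a))) \<in> ?M \<rightarrow>\<^sub>M borel \<Otimes>\<^sub>M borel" by measurable
    from measurable_compose[OF this weight_step_measurable] t
    show "(\<lambda>a. weight_step m G \<theta> p (Suc t) (\<xi> t k (fst a)) (snd (snd a))) \<in> borel_measurable ?M" by simp
  qed auto
  moreover have "(\<lambda>a. backward_mean t h (fst a) (snd (snd a))) \<in> borel_measurable ?M"
  proof -
    have "(\<lambda>a. (fst a, snd (snd a))) \<in> ?M \<rightarrow>\<^sub>M Fld t \<Otimes>\<^sub>M borel" by measurable
    from measurable_compose[OF this backward_mean_measurable[OF h]] show ?thesis by simp
  qed
  ultimately show ?thesis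
    unfolding increment_def case_prod_beta by (rule borel_measurable_times)
qed

lemma increment_bound:
  assumes t: "Suc t \<le> T" and c: "\<And>x. x \<in> space (pathspace (Suc t)) \<Longrightarrow> \<bar>h x\<bar> \<le> c"
  shows "\<bar>increment t h w z\<bar> \<le> K\<omega> * c"
  using weight_step_le[of "Suc t"] weight_step_nonneg[of "Suc t"] backward_mean_bound[OF t c] t K_pos
  by (auto simp: increment_def abs_mult intro!: mult_mono)

text \<open>In the mean the factors \<open>\<theta>\<close> and \<open>p\<close> of the proposal
  cancel those in the weight, leaving \<open>m * G\<close>, to which
  \<open>sum_M_backward_mean\<close> applies. The proposal survives only in the normalizer, which is
  the same for every \<open>h\<close>.\<close>

lemma increment_mean:
  assumes t: "Suc t \<le> T" and h: "h \<in> bounded_measurable (Suc t)" and w: "w \<in> alive_set t"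
  shows "(\<integral>z. increment t h w z \<partial>step_law t w) = real N * S t (L t h) w / normalizer t w"
proof -
  have t': "Suc t \<in> {1..T}" using t by auto
  have wsp: "w \<in> space Pr" using w alive_subset by auto
  obtain c where c: "\<And>x. x \<in> space (pathspace (Suc t)) \<Longrightarrow> \<bar>h x\<bar> \<le> c"
    using bounded_measurableD(2)[OF h] by auto
  have "increment t h w \<in> borel_measurable (count_space {1..N} \<Otimes>\<^sub>M borel)"
    using measurable_compose[OF measurable_Pair1' increment_measurable[OF t h], of w] wsp by (simp add: space_Fld)
  then have inc: "increment t h w \<in> borel_measurable (step_law t w)"
    using sets_step_law by (simp cong: measurable_cong_sets)
  have "integrable (step_law t w) (increment t h w)"
    using increment_bound[OF t c, where w=w] inc
    by (intro finite_measure.integrable_const_bound[OF prob_space.finite_measure[OF prob_space_step_law[OF t w]],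
        where B="K\<omega> * c"] AE_I2) simp_all
  then have "(\<integral>z. increment t h w z \<partial>step_law t w) = (\<Sum>j=1..N. \<integral>x.
      W t j w * \<theta> (Suc t) (\<xi> t j w) / normalizer t w * p (Suc t) (\<xi> t j w) x * increment t h w (j, x) \<partial>\<nu>)"
    unfolding step_law_def
    by (intro integral_mixture[OF _ ref_sigma_finite(1) step_weight_nonneg p_measurable p_nonneg]) (use t t' in auto)
  also have "\<dots> = (\<Sum>j=1..N. \<integral>x. W t j w / normalizer t w *
      (m (\<xi> t j w) x * (G (Suc t) x * backward_mean t h w x)) \<partial>\<nu>)"
  proof (intro sum.cong refl Bochner_Integration.integral_cong)
    fix j x
    let ?z = "\<xi> t j w"
    have \<theta>: "\<theta> (Suc t) ?z \<noteq> 0" using \<theta>_pos[OF t', of ?z] by simp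
    \<comment> \<open>Where \<open>p\<close> vanishes the weight is a division by zero;
      \<open>p_pos\<close> makes the numerator vanish too, so the cancellation holds
      everywhere.\<close>
    have "p (Suc t) ?z x = 0 \<Longrightarrow> m ?z x * G (Suc t) x = 0"
      using p_pos[OF t', of ?z x] m_nonneg[of ?z x] G_nonneg[of "Suc t" x]
      by (metis less_irrefl mult_nonneg_nonneg order_le_imp_less_or_eq)
    then have "\<theta> (Suc t) ?z * p (Suc t) ?z x * weight_step m G \<theta> p (Suc t) ?z x = m ?z x * G (Suc t) x"
      using \<theta> by (cases "p (Suc t) ?z x = 0") (auto simp: weight_step_def)
    then have "(W t j w / normalizer t w) * (\<theta> (Suc t) ?z * p (Suc t) ?z x * weight_step m G \<theta> p (Suc t) ?z x) *
       backward_mean t h w x = (W t j w / normalizer t w) * (m ?z x * G (Suc t) x) * backward_mean t h w x"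
      by simp
    then show "W t j w * \<theta> (Suc t) ?z / normalizer t w * p (Suc t) ?z x * increment t h w (j, x) =
      W t j w / normalizer t w * (m ?z x * (G (Suc t) x * backward_mean t h w x))"
      by (simp add: increment_def mult_ac)
  qed
  also have "\<dots> = (\<Sum>j=1..N. W t j w * (\<integral>x. m (\<xi> t j w) x * (G (Suc t) x * backward_mean t h w x) \<partial>\<nu>)) / normalizer t w"
    by (simp add: sum_divide_distrib)
  also have "\<dots> = real N * S t (L t h) w / normalizer t w"
    unfolding sum_M_backward_mean[OF t h wsp] ..
  finally show ?thesis .
qed

text \<open>Given \<open>Fld t\<close>, the path sum at \<open>Suc t\<close> is an average of
  \<open>N\<close> i.i.d. terms of size at most \<open>K\<omega> * c\<close>. That the set is an
  event is needed for the union bounds in \<open>deviation\<close>.\<close>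

lemma
  assumes t: "Suc t \<le> T" and h: "h \<in> bounded_measurable (Suc t)"
    and c: "\<And>x. x \<in> space (pathspace (Suc t)) \<Longrightarrow> \<bar>h x\<bar> \<le> c" and c0: "0 < c" and \<epsilon>: "0 \<le> \<epsilon>"
  shows hoeffding_step_sets:
      "{w \<in> alive_set t. \<epsilon> \<le> \<bar>S (Suc t) h w - real N * S t (L t h) w / normalizer t w\<bar>} \<in> events" (is "?A \<in> _")
    and hoeffding_step:
      "prob {w \<in> alive_set t. \<epsilon> \<le> \<bar>S (Suc t) h w - real N * S t (L t h) w / normalizer t w\<bar>}
        \<le> 2 * exp (- (real N * \<epsilon>\<^sup>2 / (2 * (K\<omega> * c)\<^sup>2)))"
proof -
  have t': "Suc t \<in> {1..T}" "t \<le> T" using t by auto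
  have iid: "cond_iid_on Pr (Fld t) (alive_set t) {1..N} (count_space {1..N} \<Otimes>\<^sub>M borel)
      (\<lambda>i w. (I (Suc t) i w, \<xi> (Suc t) i w)) (selection_mutation_law N \<theta> P \<xi> W (Suc t))"
    \<comment> \<open>The law at time \<open>Suc t\<close> is conditional on time
      \<open>Suc t - 1\<close>, that is, on \<open>Fld t\<close>.\<close>
    using selection_mutation[OF t'(1)] unfolding diff_Suc_1 .
  have pos: "0 < K\<omega> * c" using c0 K_pos by simp
  have ne: "{1..N} \<noteq> {}" using N_pos by simp
  have eq: "?A = {w \<in> alive_set t. \<epsilon> \<le> \<bar>(\<Sum>i=1..N. increment t h w (I (Suc t) i w, \<xi> (Suc t) i w)) / real (card {1..N})
      - (\<integral>z. increment t h w z \<partial>step_law t w)\<bar>}"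
    unfolding S_Suc_increment using increment_mean[OF t h] by auto
  note H = prob_space_axioms subalgebra_Fld[OF t'(2)] alive_in_Fld finite_atLeastAtMost ne iid
    prob_space_step_law[OF t] sets_step_law measure_step_law_measurable[OF t] measure_step_law[OF t, symmetric]
    increment_measurable[OF t h] increment_bound[OF t c] pos \<epsilon>
  show "?A \<in> events" unfolding eq by (rule cond_hoeffding_sets[OF H])
  show "prob ?A \<le> 2 * exp (- (real N * \<epsilon>\<^sup>2 / (2 * (K\<omega> * c)\<^sup>2)))"
    unfolding eq using cond_hoeffding[OF H] by simp
qed

text \<open>The initial particles are i.i.d. without conditioning. The factor \<open>r0\<close> in
  the weight turns the integral over \<open>\<rho>0\<close> into one over \<open>\<chi>0\<close>,
  which is \<open>\<gamma> 0 h\<close>.\<close>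

lemma hoeffding_base:
  assumes h: "h \<in> bounded_measurable 0"
    and c: "\<And>x. x \<in> space (pathspace 0) \<Longrightarrow> \<bar>h x\<bar> \<le> c" and c0: "0 < c" and \<epsilon>: "0 \<le> \<epsilon>"
  shows "prob {w \<in> space Pr. \<epsilon> \<le> \<bar>S 0 h w - \<gamma> 0 h\<bar>} \<le> 2 * exp (- (real N * \<epsilon>\<^sup>2 / (2 * (K\<omega> * c)\<^sup>2)))"
proof -
  define u where "u x = weight_init r0 G x * h ((\<lambda>_. undefined)(0 := x))" for x
  note [measurable] = bounded_measurableD(1)[OF h] weight_init_measurable r0_meas
  have um[measurable]: "u \<in> borel_measurable borel" unfolding u_def[abs_def] by measurable
  have ub: "\<bar>u x\<bar> \<le> K\<omega> * c" for x
    using weight_init_le[of x] c[OF singleton_path_in_space, of x] K_pos r0_nonneg[of x] G_nonneg[of 0 x]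
    by (auto simp: u_def abs_mult weight_init_def intro!: mult_mono)
  have S0: "S 0 h w = (\<Sum>i=1..N. u (\<xi> 0 i w)) / real (card {1..N})" for w
    by (simp add: S_def sum_paths_0 R_0 path_0 W_0 u_def)
  have mean: "(\<integral>z. z \<partial>distr \<rho>0 borel u) = \<gamma> 0 h"
  proof -
    have "(\<integral>z. z \<partial>distr \<rho>0 borel u) = (\<integral>x. u x \<partial>\<rho>0)"
      using proposal_init(2) by (subst integral_distr) (auto cong: measurable_cong_sets)
    also have "\<dots> = (\<integral>x. r0 x * (G 0 x * h ((\<lambda>_. undefined)(0 := x))) \<partial>\<rho>0)"
      by (simp add: u_def weight_init_def mult.assoc)
    also have "\<dots> = \<gamma> 0 h"
    proof -
      have "(\<lambda>x. G 0 x * h ((\<lambda>_. undefined)(0 := x))) \<in> borel_measurable borel" by measurable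
      then show ?thesis
        unfolding joint_integral_0 r0_density using r0_nonneg proposal_init(2)
        by (subst integral_real_density) (auto cong: measurable_cong_sets)
    qed
    finally show ?thesis .
  qed
  have indep: "indep_vars (\<lambda>_. borel) (\<lambda>i w. u (\<xi> 0 i w)) {1..N}"
    by (rule indep_vars_compose2[OF initial_indep]) simp
  have law: "distr Pr borel (\<lambda>w. u (\<xi> 0 i w)) = distr \<rho>0 borel u" if "i \<in> {1..N}" for i
  proof -
    have "distr (distr Pr borel (\<xi> 0 i)) borel u = distr Pr borel (\<lambda>w. u (\<xi> 0 i w))"
      using initial_measurable[OF that] by (subst distr_distr) (auto simp: comp_def)
    then show ?thesis by (simp add: initial_law[OF that])
  qed
  have "0 < K\<omega> * c" using c0 K_pos by simp
  from hoeffding_bounded_iid[OF finite_atLeastAtMost _ indep law ub this \<epsilon>] N_pos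
  show ?thesis unfolding mean S0 by simp
qed

end

section \<open>Deviation of the path sums\<close>

context bounded_smc_model
begin

text \<open>The value approximated by the ratio of the path sums of
  \<open>L t (\<lambda>_. 1)\<close> and of \<open>\<lambda>_. 1\<close>: the factor by which the
  total mass changes in one step.\<close>

definition \<beta> :: "nat \<Rightarrow> real" where
  "\<beta> t = \<gamma> (Suc t) (\<lambda>_. 1) / \<gamma> t (\<lambda>_. 1)"

text \<open>The factor by which tolerances shrink on the way back from \<open>Suc t\<close> to
  \<open>t\<close>. \<open>Kg * \<kappa> t \<le> \<beta> t / 8\<close> makes the inherited error
  small against \<open>\<beta> t\<close>; the cap 1 keeps tolerances at most 1.\<close>

definition \<kappa> :: "nat \<Rightarrow> real" where
  "\<kappa> t = min 1 (\<beta> t / (8 * Kg))"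

text \<open>4 collects two Hoeffding bounds, for \<open>h\<close> and for 1; the doubled term is the
  induction hypothesis for their images under \<open>L t\<close>.\<close>

primrec dev_factor :: "nat \<Rightarrow> real" where
  "dev_factor 0 = 4"
| "dev_factor (Suc t) = 4 + 2 * dev_factor t"

text \<open>Hoeffding exponents: a tolerance of half the mass gives
  \<open>(1 / 2)\<^sup>2 / 2 = 1 / 8\<close>, and a quarter of the predicted mass bound
  \<open>\<beta> t / (2 * K\<theta>)\<close> gives \<open>(1 / 4)\<^sup>2 / 2 = 1 / 32\<close>. The
  other entry is the earlier rate at a tolerance shrunk by \<open>\<kappa> t\<close>.\<close>

primrec dev_rate :: "nat \<Rightarrow> real" where
  "dev_rate 0 = (\<gamma> 0 (\<lambda>_. 1))\<^sup>2 / (8 * K\<omega>\<^sup>2)"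
| "dev_rate (Suc t) = min ((\<beta> t / (2 * K\<theta>))\<^sup>2 / (32 * K\<omega>\<^sup>2)) (dev_rate t * (\<kappa> t)\<^sup>2)"

lemma \<beta>_pos: "Suc t \<le> T \<Longrightarrow> 0 < \<beta> t"
  unfolding \<beta>_def by (intro divide_pos_pos \<gamma>_1_pos) auto

lemma \<kappa>_pos: "Suc t \<le> T \<Longrightarrow> 0 < \<kappa> t"
  unfolding \<kappa>_def using \<beta>_pos[of t] K_pos by simp

lemma dev_factor_pos: "0 < dev_factor t"
  by (induction t) auto

lemma dev_rate_pos: "t \<le> T \<Longrightarrow> 0 < dev_rate t"
proof (induction t)
  case 0
  then show ?case using \<gamma>_1_pos[of 0] K_pos by simp
next
  case (Suc t)
  then show ?case using \<beta>_pos[of t] \<kappa>_pos[of t] K_pos by simp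
qed

end

context smc_run
begin

text \<open>Extinction counts as a deviation, so that a ratio with denominator 0 never passes as
  accurate and one induction bounds both probabilities.\<close>

definition bad :: "nat \<Rightarrow> ((nat \<Rightarrow> 'x) \<Rightarrow> real) \<Rightarrow> real \<Rightarrow> 'w set" where
  "bad t h a = {w \<in> space Pr. w \<notin> alive_set t \<or>
     a \<le> \<bar>S t h w / S t (\<lambda>_. 1) w - \<gamma> t h / \<gamma> t (\<lambda>_. 1)\<bar>}"

lemma Fld_sets: "t \<le> T \<Longrightarrow> A \<in> sets (Fld t) \<Longrightarrow> A \<in> events"
  using subalgebra_Fld by (auto simp: subalgebra_def)

lemma bad_sets_Fld:
  assumes h: "h \<in> bounded_measurable t"
  shows "bad t h a \<in> sets (Fld t)"
proof -
  have "{w \<in> space (Fld t). a \<le> \<bar>S t h w / S t (\<lambda>_. 1) w - \<gamma> t h / \<gamma> t (\<lambda>_. 1)\<bar>} \<in> sets (Fld t)" (is "?A \<in> _")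
    by (intro borel_measurable_le borel_measurable_const borel_measurable_abs borel_measurable_diff
      borel_measurable_divide S_measurable[OF order.refl h] S_measurable[OF order.refl bounded_measurable_const])
  moreover have "bad t h a = (space (Fld t) - alive_set t) \<union> ?A"
    unfolding bad_def space_Fld by auto
  ultimately show ?thesis using alive_in_Fld[of t] by auto
qed

lemma bad_sets: "t \<le> T \<Longrightarrow> h \<in> bounded_measurable t \<Longrightarrow> bad t h a \<in> events"
  by (rule Fld_sets[OF _ bad_sets_Fld])

lemma S_1_pos: "w \<in> alive_set t \<Longrightarrow> 0 < S t (\<lambda>_. 1) w"
  using N_pos by (auto simp: S_1 alive_def)

lemma prob_Un2_le:
  assumes "A \<in> events" "B \<in> events" "C \<subseteq> A \<union> B" "prob A \<le> a" "prob B \<le> b"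
  shows "prob C \<le> a + b"
proof -
  have "prob C \<le> prob (A \<union> B)" using assms by (intro finite_measure_mono) auto
  also have "\<dots> \<le> prob A + prob B" using assms by (intro measure_Un_le)
  finally show ?thesis using assms by linarith
qed

lemma exp_rate_mono:
  assumes "C' \<le> (C::real)" "0 \<le> x"
  shows "exp (- (C * x)) \<le> exp (- (C' * x))"
  using assms by (simp add: mult_right_mono)

text \<open>The error at \<open>Suc t\<close> splits into the sampling fluctuation around the
  conditional mean and the error of that mean, inherited from time \<open>t\<close>; each is allowed
  half of \<open>c * \<delta>\<close>. Tolerances are relative to \<open>c\<close>, so the same
  \<open>\<delta>\<close> serves \<open>h\<close> and 1.\<close>

lemma deviation:
  assumes t: "t \<le> T" and h: "h \<in> bounded_measurable t"
    and c: "\<And>x. x \<in> space (pathspace t) \<Longrightarrow> \<bar>h x\<bar> \<le> c" and c0: "0 < c" and \<delta>: "0 < \<delta>" "\<delta> \<le> 1"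
  shows "prob (bad t h (c * \<delta>)) \<le> dev_factor t * exp (- (dev_rate t * (real N * \<delta>\<^sup>2)))"
  using assms
proof (induction t arbitrary: h c \<delta>)
  case 0
  let ?b0 = "\<gamma> 0 (\<lambda>_. 1)"
  have b0: "0 < ?b0" using \<gamma>_1_pos[of 0] by simp
  have one: "(\<lambda>_. 1) \<in> bounded_measurable 0" by (rule bounded_measurable_const)
  define A1 where "A1 = {w \<in> space Pr. ?b0 * c * \<delta> / 2 \<le> \<bar>S 0 h w - \<gamma> 0 h\<bar>}"
  define A2 where "A2 = {w \<in> space Pr. ?b0 * \<delta> / 2 \<le> \<bar>S 0 (\<lambda>_. 1) w - ?b0\<bar>}"
  have Sm: "S 0 f \<in> borel_measurable Pr" if "f \<in> bounded_measurable 0" for f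
    using measurable_from_subalg[OF subalgebra_Fld S_measurable[OF order.refl that]] by simp
  have ev: "A1 \<in> events" "A2 \<in> events"
    unfolding A1_def A2_def
    by (intro borel_measurable_le borel_measurable_const borel_measurable_abs borel_measurable_diff Sm 0 one)+
  \<comment> \<open>The sup bound \<open>a\<close> cancels, so one rate serves both \<open>h\<close>
    and 1.\<close>
  have e: "exp (- (real N * (?b0 * a * \<delta> / 2)\<^sup>2 / (2 * (K\<omega> * a)\<^sup>2))) = exp (- (dev_rate 0 * (real N * \<delta>\<^sup>2)))" if "0 < a" for a
    using that K_pos by (simp add: field_simps power2_eq_square)
  have p1: "prob A1 \<le> 2 * exp (- (dev_rate 0 * (real N * \<delta>\<^sup>2)))"
    unfolding A1_def using hoeffding_base[OF "0.prems"(2) "0.prems"(3) "0.prems"(4), of "?b0 * c * \<delta> / 2"] e[OF "0.prems"(4)] b0 0 by simp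
  have p2: "prob A2 \<le> 2 * exp (- (dev_rate 0 * (real N * \<delta>\<^sup>2)))"
    unfolding A2_def using hoeffding_base[OF one, of 1 "?b0 * 1 * \<delta> / 2"] e[of 1] b0 0 by simp
  have "bad 0 h (c * \<delta>) \<subseteq> A1 \<union> A2"
  proof (rule subsetI, rule ccontr)
    fix w assume w: "w \<in> bad 0 h (c * \<delta>)" and n: "w \<notin> A1 \<union> A2"
    from w have wsp: "w \<in> space Pr" by (simp add: bad_def)
    have d1: "\<bar>S 0 h w - \<gamma> 0 h\<bar> < ?b0 * c * \<delta> / 2" and d2: "\<bar>S 0 (\<lambda>_. 1) w - ?b0\<bar> < ?b0 * \<delta> / 2"
      using n wsp by (auto simp: A1_def A2_def not_le)
    \<comment> \<open>\<open>\<delta> \<le> 1\<close> keeps the total mass above half of its limit,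
      which yields survival.\<close>
    have "?b0 * \<delta> / 2 \<le> ?b0 / 2" using b0 0 by simp
    then have b: "0 < S 0 (\<lambda>_. 1) w" using d2 b0 by linarith
    then have al: "w \<in> alive_set 0"
      using N_pos wsp by (simp add: alive_def S_1 zero_less_divide_iff)
    have "\<bar>S 0 h w / S 0 (\<lambda>_. 1) w - \<gamma> 0 h / ?b0\<bar> \<le> (\<bar>S 0 h w - \<gamma> 0 h\<bar> + c * \<bar>S 0 (\<lambda>_. 1) w - ?b0\<bar>) / ?b0"
      using abs_ratio_diff_le[OF b b0] S_bound[OF _ "0.prems"(3)] by simp
    also have "\<dots> < (?b0 * c * \<delta> / 2 + c * (?b0 * \<delta> / 2)) / ?b0"
      using d1 d2 0 b0 by (intro divide_strict_right_mono add_strict_mono mult_strict_left_mono) auto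
    also have "\<dots> = c * \<delta>" using b0 by (simp add: field_simps)
    finally show False using w al by (simp add: bad_def)
  qed
  from prob_Un2_le[OF ev this p1 p2] show ?case by simp
next
  case (Suc t)
  note h = Suc.prems(2) and c = Suc.prems(3) and c0 = Suc.prems(4) and \<delta> = Suc.prems(5,6)
  have t: "Suc t \<le> T" "t \<le> T" using Suc.prems by auto
  let ?one = "\<lambda>_. 1 :: real"
  let ?\<beta> = "\<beta> t"
  \<comment> \<open>A lower bound for the predicted mass \<open>?b'\<close>:
    \<open>\<beta> t / 2\<close> comes from the induction hypothesis, \<open>1 / K\<theta>\<close>
    from \<open>normalizer_le\<close>.\<close>
  define gm where "gm = ?\<beta> / (2 * K\<theta>)"
  have \<beta>0: "0 < ?\<beta>" and \<kappa>0: "0 < \<kappa> t" using \<beta>_pos[OF t(1)] \<kappa>_pos[OF t(1)] .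
  have gm0: "0 < gm" unfolding gm_def using \<beta>0 K_pos by simp
  have one: "?one \<in> bounded_measurable (Suc t)" by (rule bounded_measurable_const)
  let ?pred = "\<lambda>f w. real N * S t (L t f) w / normalizer t w"
  \<comment> \<open>\<open>A1\<close> and \<open>A2\<close> are the sampling fluctuations; the two
    quarters add up to \<open>c * \<delta> / 2\<close> after division by \<open>gm\<close>.\<close>
  define A1 where "A1 = {w \<in> alive_set t. gm * c * \<delta> / 4 \<le> \<bar>S (Suc t) h w - ?pred h w\<bar>}"
  define A2 where "A2 = {w \<in> alive_set t. gm * \<delta> / 4 \<le> \<bar>S (Suc t) ?one w - ?pred ?one w\<bar>}"
  \<comment> \<open>\<open>A3\<close> and \<open>A4\<close> are the errors inherited from time
    \<open>t\<close>. \<open>L\<close> enlarges sup norms by the factor \<open>Kg\<close>, which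
    \<open>\<kappa> t\<close> compensates.\<close>
  define A3 where "A3 = bad t (L t h) (Kg * c * (\<delta> * \<kappa> t))"
  define A4 where "A4 = bad t (L t ?one) (Kg * 1 * (\<delta> * \<kappa> t))"
  let ?E1 = "exp (- (gm\<^sup>2 / (32 * K\<omega>\<^sup>2) * (real N * \<delta>\<^sup>2)))"
  let ?E2 = "exp (- (dev_rate t * (\<kappa> t)\<^sup>2 * (real N * \<delta>\<^sup>2)))"
  let ?E = "exp (- (dev_rate (Suc t) * (real N * \<delta>\<^sup>2)))"
  have E: "?E1 \<le> ?E" "?E2 \<le> ?E"
    by (intro exp_rate_mono; simp add: gm_def)+
  have e: "exp (- (real N * (gm * a * \<delta> / 4)\<^sup>2 / (2 * (K\<omega> * a)\<^sup>2))) = ?E1" if "0 < a" for a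
    using that K_pos by (simp add: field_simps power2_eq_square)
  have nn: "0 \<le> gm * c * \<delta> / 4" "0 \<le> gm * 1 * \<delta> / 4" using gm0 c0 \<delta> by simp_all
  have "prob A1 \<le> 2 * ?E1"
    unfolding A1_def by (rule hoeffding_step[OF t(1) h c c0 nn(1), unfolded e[OF c0]])
  then have p1: "prob A1 \<le> 2 * ?E" using E(1) by linarith
  have ev1: "A1 \<in> events"
    unfolding A1_def by (rule hoeffding_step_sets[OF t(1) h c c0 nn(1)])
  have A2': "A2 = {w \<in> alive_set t. gm * 1 * \<delta> / 4 \<le> \<bar>S (Suc t) ?one w - ?pred ?one w\<bar>}"
    by (simp add: A2_def)
  have "prob A2 \<le> 2 * ?E1"
    unfolding A2' 
    using hoeffding_step[OF t(1) one _ zero_less_one nn(2)] unfolding e[OF zero_less_one] by simp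
  then have p2: "prob A2 \<le> 2 * ?E" using E(1) by linarith
  have ev2: "A2 \<in> events"
    unfolding A2' by (rule hoeffding_step_sets[OF t(1) one _ _ nn(2), where c=1]) simp_all
  have \<delta>': "0 < \<delta> * \<kappa> t" "\<delta> * \<kappa> t \<le> 1"
    using \<delta> \<kappa>0 by (auto simp: \<kappa>_def intro: mult_le_one)
  have sq: "dev_rate t * (real N * (\<delta> * \<kappa> t)\<^sup>2) = dev_rate t * (\<kappa> t)\<^sup>2 * (real N * \<delta>\<^sup>2)"
    by (simp add: power_mult_distrib mult_ac)
  have IH: "prob (bad t (L t f) (Kg * a * (\<delta> * \<kappa> t))) \<le> dev_factor t * ?E"
    if f: "f \<in> bounded_measurable (Suc t)" and a: "\<And>x. x \<in> space (pathspace (Suc t)) \<Longrightarrow> \<bar>f x\<bar> \<le> a" "0 < a" for f a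
  proof -
    have "prob (bad t (L t f) (Kg * a * (\<delta> * \<kappa> t))) \<le> dev_factor t * exp (- (dev_rate t * (real N * (\<delta> * \<kappa> t)\<^sup>2)))"
      by (rule Suc.IH[OF t(2) L_bounded_measurable[OF f t(1)] L_bound[OF f t(1) _ a(1)] _ \<delta>'])
        (use K_pos a in auto)
    also have "\<dots> \<le> dev_factor t * ?E"
      unfolding sq using E(2) dev_factor_pos[of t] by (intro mult_left_mono) auto
    finally show ?thesis .
  qed
  have p3: "prob A3 \<le> dev_factor t * ?E" unfolding A3_def by (rule IH[OF h c c0])
  have p4: "prob A4 \<le> dev_factor t * ?E" unfolding A4_def by (rule IH[OF one]) auto
  have ev3: "A3 \<in> events" "A4 \<in> events"
    unfolding A3_def A4_def by (intro bad_sets t L_bounded_measurable h one)+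
  have "bad (Suc t) h (c * \<delta>) \<subseteq> (A1 \<union> A2) \<union> (A3 \<union> A4)"
  proof (rule subsetI, rule ccontr)
    fix w assume w: "w \<in> bad (Suc t) h (c * \<delta>)" and n: "w \<notin> (A1 \<union> A2) \<union> (A3 \<union> A4)"
    from w have wsp: "w \<in> space Pr" by (simp add: bad_def)
    \<comment> \<open>Extinction up to time \<open>t\<close> is part of \<open>A3\<close>.\<close>
    have al: "w \<in> alive_set t" using n wsp by (auto simp: A3_def bad_def)
    let ?s = "S t ?one w" and ?D = "normalizer t w"
    let ?b = "S (Suc t) ?one w" and ?b' = "?pred ?one w"
    let ?A = "S t (L t h) w / ?s" and ?B = "S t (L t ?one) w / ?s"
    let ?Alim = "\<gamma> t (L t h) / \<gamma> t ?one"
    have s0: "0 < ?s" by (rule S_1_pos[OF al])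
    have D0: "0 < ?D" by (rule normalizer_pos[OF t(1) al])
    have \<gamma>0: "0 < \<gamma> t ?one" "0 < \<gamma> (Suc t) ?one" using \<gamma>_1_pos t by auto
    have B0: "\<gamma> t (L t ?one) / \<gamma> t ?one = ?\<beta>" by (simp add: \<beta>_def joint_integral_Suc)
    have d1: "\<bar>S (Suc t) h w - ?pred h w\<bar> < gm * c * \<delta> / 4" and d2: "\<bar>?b - ?b'\<bar> < gm * \<delta> / 4"
      using n al by (auto simp: A1_def A2_def not_le)
    \<comment> \<open>An eighth suffices: the errors of \<open>?A\<close> and \<open>?B\<close> are
      added and divided by the lower bound \<open>\<beta> t / 2\<close> of \<open>?B\<close>, and
      (1/8 + 1/8) / (1/2) = 1/2.\<close>
    have \<kappa>: "Kg * \<kappa> t \<le> ?\<beta> / 8"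
      using K_pos by (simp add: \<kappa>_def min_def field_simps)
    have \<kappa>a: "Kg * a * (\<delta> * \<kappa> t) \<le> a * (?\<beta> * \<delta> / 8)" if "0 < a" for a
      using mult_left_mono[OF \<kappa>, of "a * \<delta>"] that \<delta> by (simp add: mult_ac)
    have d3: "\<bar>?A - ?Alim\<bar> < c * (?\<beta> * \<delta> / 8)"
      using n wsp \<kappa>a[OF c0] by (auto simp: A3_def bad_def not_le)
    have d4: "\<bar>?B - ?\<beta>\<bar> < ?\<beta> * \<delta> / 8"
      using n wsp \<kappa>a[of 1] B0 by (auto simp: A4_def bad_def not_le)
    have "?\<beta> * \<delta> / 8 \<le> ?\<beta> / 8" using \<beta>0 \<delta> by simp
    then have "?\<beta> / 2 \<le> x \<and> 0 < x" if "\<bar>x - ?\<beta>\<bar> < ?\<beta> * \<delta> / 8" for x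
      using that \<beta>0 by linarith
    from this[OF d4] have B2: "?\<beta> / 2 \<le> ?B" and B_pos: "0 < ?B" by auto
    have "?D \<le> K\<theta> * (real N * ?s)"
      using normalizer_le[OF t(1), of w] N_pos by (simp add: S_1)
    then have "1 / K\<theta> \<le> real N * ?s / ?D" using D0 K_pos by (simp add: field_simps)
    with B2 have "(?\<beta> / 2) * (1 / K\<theta>) \<le> ?B * (real N * ?s / ?D)"
      using \<beta>0 K_pos B_pos by (intro mult_mono) auto
    also have "\<dots> = ?b'" using s0 by simp
    finally have b': "gm \<le> ?b'" by (simp add: gm_def)
    then have b'0: "0 < ?b'" using gm0 by linarith
    \<comment> \<open>As \<open>\<delta> \<le> 1\<close>, a fluctuation below \<open>gm / 4\<close>
      cannot bring a mass of at least \<open>gm\<close> down to 0, so the new weights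
      survive.\<close>
    have "gm * \<delta> / 4 \<le> gm / 4" using gm0 \<delta> by simp
    then have "0 < x" if "\<bar>x - z\<bar> < gm * \<delta> / 4" "gm \<le> z" for x z
      using that gm0 by linarith
    from this[OF d2 b'] have b0: "0 < ?b" .
    then have al': "w \<in> alive_set (Suc t)"
      using al N_pos by (simp add: alive_Suc S_1 zero_less_divide_iff)
    \<comment> \<open>The random normalizer drops out here.\<close>
    have ratio: "?pred h w / ?b' = ?A / ?B"
      using s0 D0 N_pos by simp
    have "\<bar>S (Suc t) h w / ?b - ?A / ?B\<bar> \<le> (\<bar>S (Suc t) h w - ?pred h w\<bar> + c * \<bar>?b - ?b'\<bar>) / ?b'"
      using abs_ratio_diff_le[OF b0 b'0, of "S (Suc t) h w" c "?pred h w"] S_bound[OF t(1) c] unfolding ratio by simp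
    also have "\<dots> \<le> (\<bar>S (Suc t) h w - ?pred h w\<bar> + c * \<bar>?b - ?b'\<bar>) / gm"
      by (intro divide_left_mono mult_pos_pos add_nonneg_nonneg mult_nonneg_nonneg abs_ge_zero b' b'0 gm0
        less_imp_le[OF c0])
    also have "\<dots> < (gm * c * \<delta> / 4 + c * (gm * \<delta> / 4)) / gm"
      using d1 d2 gm0 c0 by (intro divide_strict_right_mono add_strict_mono mult_strict_left_mono) auto
    also have "\<dots> = c * \<delta> / 2" using gm0 by (simp add: field_simps)
    finally have r1: "\<bar>S (Suc t) h w / ?b - ?A / ?B\<bar> < c * \<delta> / 2" .
    have "\<bar>\<gamma> (Suc t) h\<bar> \<le> c * \<gamma> (Suc t) ?one" by (rule \<gamma>_abs_le[OF h t(1) c])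
    then have "\<bar>?Alim\<bar> \<le> c * ?\<beta>"
      using \<gamma>0 by (simp add: \<beta>_def joint_integral_Suc divide_right_mono abs_divide)
    \<comment> \<open>The limiting ratio is the one bounded by \<open>c\<close>, and the random
      \<open>?B\<close>, bounded below by \<open>\<beta> t / 2\<close>, is the remaining
      denominator.\<close>
    from abs_ratio_diff_le[OF \<beta>0 B_pos this, of ?A]
    have "\<bar>?A / ?B - ?Alim / ?\<beta>\<bar> \<le> (\<bar>?A - ?Alim\<bar> + c * \<bar>?B - ?\<beta>\<bar>) / ?B"
      by (simp only: abs_minus_commute)
    also have "\<dots> \<le> (\<bar>?A - ?Alim\<bar> + c * \<bar>?B - ?\<beta>\<bar>) / (?\<beta> / 2)"
      by (intro divide_left_mono mult_pos_pos add_nonneg_nonneg mult_nonneg_nonneg abs_ge_zero B2 B_pos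
        half_gt_zero \<beta>0 less_imp_le[OF c0])
    also have "\<dots> < (c * (?\<beta> * \<delta> / 8) + c * (?\<beta> * \<delta> / 8)) / (?\<beta> / 2)"
      using d3 d4 \<beta>0 c0 by (intro divide_strict_right_mono add_strict_mono mult_strict_left_mono) auto
    also have "\<dots> = c * \<delta> / 2" using \<beta>0 by (simp add: field_simps)
    finally have r2: "\<bar>?A / ?B - ?Alim / ?\<beta>\<bar> < c * \<delta> / 2" .
    have "?Alim / ?\<beta> = \<gamma> (Suc t) h / \<gamma> (Suc t) ?one"
      using \<gamma>0 by (simp add: \<beta>_def joint_integral_Suc)
    with r1 r2 have "\<bar>S (Suc t) h w / ?b - \<gamma> (Suc t) h / \<gamma> (Suc t) ?one\<bar> < c * \<delta>" by linarith
    then show False using w al' by (simp add: bad_def)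
  qed
  from prob_Un2_le[OF _ _ this prob_Un2_le[OF ev1 ev2 order.refl p1 p2] prob_Un2_le[OF ev3 order.refl p3 p4]]
  have "prob (bad (Suc t) h (c * \<delta>)) \<le> (2 * ?E + 2 * ?E) + (dev_factor t * ?E + dev_factor t * ?E)"
    using ev1 ev2 ev3 by auto
  also have "\<dots> = dev_factor (Suc t) * ?E" by (simp add: algebra_simps)
  finally show ?case .
qed

end

section \<open>Backward simulation\<close>

context smc_run
begin

text \<open>The coefficients of the values of \<open>h\<close> in \<open>S T h\<close> divided by
  \<open>S T (\<lambda>_. 1)\<close>; on the survival event they form a probability vector on index
  paths.\<close>

definition backward_law :: "'w \<Rightarrow> (nat \<Rightarrow> nat) \<Rightarrow> real" where
  "backward_law w j = W T (j T) w / (\<Sum>i=1..N. W T i w) * R T w j"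

lemma backward_law_nonneg: "0 \<le> backward_law w j"
  unfolding backward_law_def
  by (intro mult_nonneg_nonneg divide_nonneg_nonneg W_nonneg sum_nonneg R_nonneg order.refl)

lemma sum_backward_law:
  assumes "w \<in> alive_set T"
  shows "(\<Sum>j\<in>paths T. backward_law w j) = 1"
proof -
  have "0 < (\<Sum>i=1..N. W T i w)" using assms by (simp add: alive_def)
  then show ?thesis
    unfolding backward_law_def using sum_R[of "\<lambda>i. W T i w / (\<Sum>i=1..N. W T i w)" T w]
    by (simp add: sum_divide_distrib[symmetric])
qed

text \<open>The two differ only where the common denominator is 0: division by zero gives 0 on the
  left, the uniform law \<open>1 / real N\<close> on the right.\<close>

lemma backward_kernel_le_bk:
  assumes "t \<le> T"
  shows "backward_kernel N m \<xi> W t w i j \<le> bk t w (\<xi> (Suc t) i w) j"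
  by (simp add: backward_kernel_def bk_def)

lemma backward_kernel_nonneg: "t \<le> T \<Longrightarrow> 0 \<le> backward_kernel N m \<xi> W t w i j"
  unfolding backward_kernel_def
  by (intro divide_nonneg_nonneg mult_nonneg_nonneg W_nonneg sum_nonneg m_nonneg)

text \<open>
  The unmodified backward law is dominated by \<open>backward_law\<close>. Being almost surely a conditional
  distribution, it has the same total mass, so the two agree.
\<close>

lemma law_eq:
  assumes w: "w \<in> alive_set T" and total: "backward_path_law N T m \<xi> W w (paths T) = 1" and A: "A \<subseteq> paths T"
  shows "backward_path_law N T m \<xi> W w A = (\<Sum>j\<in>A. backward_law w j)"
proof -
  let ?f = "\<lambda>j. W T (j T) w / (\<Sum>i=1..N. W T i w) * (\<Prod>t<T. backward_kernel N m \<xi> W t w (j (Suc t)) (j t))"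
  have le: "?f j \<le> backward_law w j" for j
    unfolding backward_law_def R_def
    by (intro mult_left_mono prod_mono conjI backward_kernel_nonneg backward_kernel_le_bk
      divide_nonneg_nonneg W_nonneg sum_nonneg) auto
  have eq: "(\<Sum>j\<in>paths T. ?f j) = (\<Sum>j\<in>paths T. backward_law w j)"
    using total sum_backward_law[OF w] by (simp add: backward_path_law_def)
  have "?f j = backward_law w j" if "j \<in> paths T" for j
    by (rule sum_mono_inv[where f="?f" and g="backward_law w", OF eq le that finite_paths])
  then show ?thesis
    unfolding backward_path_law_def using A by (intro sum.cong) auto
qed

abbreviation backward_simulation_law :: "(nat \<Rightarrow> nat \<Rightarrow> 'w \<Rightarrow> nat) \<Rightarrow> bool" where
  "backward_simulation_law J \<equiv> cond_iid_on Pr (Fld T) (alive_set T) {1..N} (count_space (paths T))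
     (\<lambda>l w. \<lambda>t\<in>{..T}. J l t w) (backward_path_law N T m \<xi> W)"

text \<open>Testing the conditional law on the sure event, with \<open>paths T\<close> in every
  slot, shows that on the survival event the \<open>N\<close>-th power of its total mass is almost
  surely 1. Hence the mass is 1 and \<open>law_eq\<close> applies.\<close>

lemma backward_iid:
  assumes sim: "backward_simulation_law J"
  shows "cond_iid_on Pr (Fld T) (alive_set T) {1..N} (count_space (paths T))
     (\<lambda>l w. \<lambda>t\<in>{..T}. J l t w) (\<lambda>w A. \<Sum>j\<in>A. backward_law w j)"
proof -
  let ?X = "\<lambda>l w. \<lambda>t\<in>{..T}. J l t w"
  interpret F: finite_measure_subalgebra Pr "Fld T" by unfold_locales (rule subalgebra_Fld[OF order.refl])
  have X: "?X l \<in> Pr \<rightarrow>\<^sub>M count_space (paths T)" if "l \<in> {1..N}" for l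
    using sim that by (simp add: cond_iid_on_def)
  have iid: "AE w in Pr. w \<in> alive_set T \<longrightarrow>
      real_cond_exp Pr (Fld T) (indicator {v \<in> space Pr. \<forall>l\<in>{1..N}. ?X l v \<in> A l}) w =
      (\<Prod>l\<in>{1..N}. backward_path_law N T m \<xi> W w (A l))" if "\<forall>l\<in>{1..N}. A l \<subseteq> paths T" for A
    using sim that by (auto simp: cond_iid_on_def)
  have all: "{v \<in> space Pr. \<forall>l\<in>{1..N}. ?X l v \<in> paths T} = space Pr"
    using measurable_space[OF X] unfolding space_count_space by blast
  have one: "AE w in Pr. real_cond_exp Pr (Fld T) (indicator (space Pr)) w = indicator (space Pr) w"
  proof (rule F.real_cond_exp_F_meas)
    show "indicat_real (space Pr) \<in> borel_measurable (Fld T)"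
      using space_Fld[of T] by (metis borel_measurable_indicator sets.top)
  qed (auto intro!: integrable_real_indicator simp: emeasure_eq_measure)
  have total: "AE w in Pr. w \<in> alive_set T \<longrightarrow> backward_path_law N T m \<xi> W w (paths T) = 1"
    using iid[of "\<lambda>_. paths T", unfolded all, OF ballI[OF order.refl]] one
  proof (eventually_elim, intro impI)
    fix w assume *: "w \<in> alive_set T \<longrightarrow> real_cond_exp Pr (Fld T) (indicator (space Pr)) w =
        (\<Prod>l\<in>{1..N}. backward_path_law N T m \<xi> W w (paths T))"
      "real_cond_exp Pr (Fld T) (indicator (space Pr)) w = indicator (space Pr) w"
      and w: "w \<in> alive_set T"
    have "0 \<le> backward_path_law N T m \<xi> W w (paths T)"
      unfolding backward_path_law_def
      by (intro sum_nonneg mult_nonneg_nonneg divide_nonneg_nonneg W_nonneg prod_nonneg backward_kernel_nonneg) auto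
    moreover have "backward_path_law N T m \<xi> W w (paths T) ^ N = 1 ^ N"
      using * w alive_subset[of T] by auto
    ultimately show "backward_path_law N T m \<xi> W w (paths T) = 1"
      using N_pos by (intro power_eq_imp_eq_base[of _ N 1]) auto
  qed
  show ?thesis
    unfolding cond_iid_on_def
  proof (intro conjI ballI allI impI X)
    fix A :: "nat \<Rightarrow> (nat \<Rightarrow> nat) set" assume "\<forall>l\<in>{1..N}. A l \<in> sets (count_space (paths T))"
    then have A: "\<forall>l\<in>{1..N}. A l \<subseteq> paths T" by auto
    from iid[OF A] total
    show "AE w in Pr. w \<in> alive_set T \<longrightarrow>
      real_cond_exp Pr (Fld T) (indicator {v \<in> space Pr. \<forall>l\<in>{1..N}. ?X l v \<in> A l}) w =
      (\<Prod>l\<in>{1..N}. \<Sum>j\<in>A l. backward_law w j)"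
      proof (eventually_elim, intro impI)
      fix w assume *: "w \<in> alive_set T \<longrightarrow>
          real_cond_exp Pr (Fld T) (indicator {v \<in> space Pr. \<forall>l\<in>{1..N}. ?X l v \<in> A l}) w =
          (\<Prod>l\<in>{1..N}. backward_path_law N T m \<xi> W w (A l))"
        "w \<in> alive_set T \<longrightarrow> backward_path_law N T m \<xi> W w (paths T) = 1"
        and w: "w \<in> alive_set T"
      have "(\<Prod>l\<in>{1..N}. backward_path_law N T m \<xi> W w (A l)) = (\<Prod>l\<in>{1..N}. \<Sum>j\<in>A l. backward_law w j)"
        using * w A by (intro prod.cong refl law_eq) blast+
      with * w show "real_cond_exp Pr (Fld T) (indicator {v \<in> space Pr. \<forall>l\<in>{1..N}. ?X l v \<in> A l}) w =
          (\<Prod>l\<in>{1..N}. \<Sum>j\<in>A l. backward_law w j)"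
        by metis
    qed
  qed
qed

lemma backward_law_measurable:
  assumes j: "j \<in> paths T"
  shows "(\<lambda>w. backward_law w j) \<in> borel_measurable (Fld T)"
  unfolding backward_law_def
proof (intro borel_measurable_times borel_measurable_divide borel_measurable_sum)
  show "W T (j T) \<in> borel_measurable (Fld T)"
    by (rule W_Fld_measurable[OF order.refl paths_mem[OF j order.refl]])
  show "(\<lambda>w. R T w j) \<in> borel_measurable (Fld T)"
    by (rule R_measurable[OF order.refl j])
qed (rule W_Fld_measurable[OF order.refl]; assumption)

text \<open>Given the particles, \<open>h\<close> along an index path is a function on the finite
  set \<open>paths T\<close>, and its mean under \<open>backward_law\<close> is exactly the ratio of
  path sums.\<close>

lemma conditional_deviation:
  assumes sim: "backward_simulation_law J" and h: "h \<in> bounded_measurable T"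
    and c: "\<And>x. x \<in> space (pathspace T) \<Longrightarrow> \<bar>h x\<bar> \<le> c" and c0: "0 < c" and \<epsilon>: "0 \<le> \<epsilon>"
  defines "D \<equiv> {w \<in> alive_set T. \<epsilon> \<le> \<bar>ffbsi_estimator N T \<xi> J h w - S T h w / S T (\<lambda>_. 1) w\<bar>}"
  shows "D \<in> events" and "prob D \<le> 2 * exp (- (real N * \<epsilon>\<^sup>2 / (2 * c\<^sup>2)))"
proof -
  let ?k = "\<lambda>w. point_measure (paths T) (\<lambda>j. ennreal (backward_law w j))"
  let ?f = "\<lambda>w j. h (path T j w)"
  have em: "emeasure (?k w) A = ennreal (\<Sum>j\<in>A. backward_law w j)" if "A \<in> sets (count_space (paths T))" for w A
    using that finite_paths by (simp add: emeasure_point_measure_finite backward_law_nonneg)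
  then have me: "measure (?k w) A = (\<Sum>j\<in>A. backward_law w j)" if "A \<in> sets (count_space (paths T))" for w A
    using that unfolding measure_def by (simp add: sum_nonneg backward_law_nonneg)
  have prob: "prob_space (?k w)" if "w \<in> alive_set T" for w
    by (rule prob_spaceI) (simp add: space_point_measure em sum_backward_law[OF that])
  have meas: "(\<lambda>w. measure (?k w) A) \<in> borel_measurable (Fld T)" if "A \<in> sets (count_space (paths T))" for A
    unfolding me[OF that] using that by (intro borel_measurable_sum backward_law_measurable) auto
  have fm: "(\<lambda>(w, j). ?f w j) \<in> borel_measurable (Fld T \<Otimes>\<^sub>M count_space (paths T))"
    unfolding case_prod_beta
  proof (rule measurable_compose_countable'[where I="paths T" and g=snd])
    fix j assume "j \<in> paths T"
    then show "(\<lambda>z. h (path T j (fst z))) \<in> borel_measurable (Fld T \<Otimes>\<^sub>M count_space (paths T))"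
      by (intro measurable_compose[OF measurable_compose[OF measurable_fst path_measurable] bounded_measurableD(1)[OF h]]) auto
  qed (auto intro: countable_finite finite_paths)
  have mean: "(\<integral>j. ?f w j \<partial>?k w) = S T h w / S T (\<lambda>_. 1) w" if "w \<in> alive_set T" for w
  proof -
    have "(\<integral>j. ?f w j \<partial>?k w) = (\<Sum>j\<in>paths T. backward_law w j * h (path T j w))"
      using finite_paths backward_law_nonneg by (simp add: lebesgue_integral_point_measure_finite)
    also have "\<dots> = (\<Sum>j\<in>paths T. W T (j T) w * R T w j * h (path T j w)) / (\<Sum>i=1..N. W T i w)"
      by (simp add: backward_law_def sum_divide_distrib)
    also have "\<dots> = S T h w / S T (\<lambda>_. 1) w"
      unfolding S_1 using N_pos by (simp add: S_def)
    finally show ?thesis .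
  qed
  have path_J: "path T (\<lambda>t\<in>{..T}. J l t w) w = (\<lambda>t\<in>{..T}. \<xi> t (J l t w) w)" for l w
    by (auto simp: path_def)
  have D: "D = {w \<in> alive_set T. \<epsilon> \<le> \<bar>(\<Sum>l\<in>{1..N}. ?f w (\<lambda>t\<in>{..T}. J l t w)) / real (card {1..N}) - (\<integral>j. ?f w j \<partial>?k w)\<bar>}"
    unfolding D_def ffbsi_estimator_def path_J using mean by auto
  have ne: "{1..N} \<noteq> {}" using N_pos by simp
  have bd: "\<bar>?f w j\<bar> \<le> c" for w j by (rule c[OF path_in_space])
  have sk: "sets (?k w) = sets (count_space (paths T))" for w by (simp add: sets_point_measure)
  note H = prob_space_axioms subalgebra_Fld[OF order.refl] alive_in_Fld finite_atLeastAtMost ne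
    backward_iid[OF sim] prob sk meas me[symmetric] fm bd c0 \<epsilon>
  show "D \<in> events" unfolding D by (rule cond_hoeffding_sets[OF H])
  show "prob D \<le> 2 * exp (- (real N * \<epsilon>\<^sup>2 / (2 * c\<^sup>2)))"
    unfolding D using cond_hoeffding[OF H] by simp
qed

text \<open>Backward sampling and particle approximation each get
  \<open>\<epsilon> / 2 = c * \<delta>\<close>. The entry \<open>1 / 2\<close> of the minimum is the
  Hoeffding rate of the former, and the division by 4 comes from
  \<open>\<delta>\<^sup>2 = \<epsilon>\<^sup>2 / (4 * c\<^sup>2)\<close>.\<close>

lemma ffbsi_deviation:
  assumes sim: "backward_simulation_law J" and h: "h \<in> bounded_measurable T"
    and c: "\<And>x. x \<in> space (pathspace T) \<Longrightarrow> \<bar>h x\<bar> \<le> c" and c0: "0 < c" and \<epsilon>: "0 < \<epsilon>" "\<epsilon> \<le> 2 * c"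
  shows "prob {w \<in> space Pr. \<epsilon> \<le> \<bar>ffbsi_estimator N T \<xi> J h w - smoothing \<chi>0 M G T h\<bar>}
    \<le> (dev_factor T + 2) * exp (- (min (dev_rate T) (1 / 2) / 4 * real N * \<epsilon>\<^sup>2 / c\<^sup>2))"
proof -
  define \<delta> where "\<delta> = \<epsilon> / (2 * c)"
  have \<delta>: "0 < \<delta>" "\<delta> \<le> 1" "c * \<delta> = \<epsilon> / 2" using \<epsilon> c0 by (auto simp: \<delta>_def)
  let ?D = "{w \<in> alive_set T. c * \<delta> \<le> \<bar>ffbsi_estimator N T \<xi> J h w - S T h w / S T (\<lambda>_. 1) w\<bar>}"
  let ?e = "exp (- (min (dev_rate T) (1 / 2) * (real N * \<delta>\<^sup>2)))"
  have "0 \<le> c * \<delta>" using \<delta> c0 by simp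
  note cd = conditional_deviation[OF sim h c c0 this]
  have "prob ?D \<le> 2 * exp (- (1 / 2 * (real N * \<delta>\<^sup>2)))"
    using cd(2) c0 by (simp add: power_mult_distrib)
  also have "\<dots> \<le> 2 * ?e"
    by (intro mult_left_mono exp_rate_mono) auto
  finally have pD: "prob ?D \<le> 2 * ?e" .
  have "prob (bad T h (c * \<delta>)) \<le> dev_factor T * exp (- (dev_rate T * (real N * \<delta>\<^sup>2)))"
    by (rule deviation[OF order.refl h c c0 \<delta>(1,2)])
  also have "\<dots> \<le> dev_factor T * ?e"
    using dev_factor_pos[of T] by (intro mult_left_mono exp_rate_mono) auto
  finally have pB: "prob (bad T h (c * \<delta>)) \<le> dev_factor T * ?e" .
  have "{w \<in> space Pr. \<epsilon> \<le> \<bar>ffbsi_estimator N T \<xi> J h w - smoothing \<chi>0 M G T h\<bar>} \<subseteq> bad T h (c * \<delta>) \<union> ?D"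
  proof (intro subsetI, rule ccontr)
    fix w assume w: "w \<in> {w \<in> space Pr. \<epsilon> \<le> \<bar>ffbsi_estimator N T \<xi> J h w - smoothing \<chi>0 M G T h\<bar>}"
      and n: "w \<notin> bad T h (c * \<delta>) \<union> ?D"
    then have d: "\<bar>ffbsi_estimator N T \<xi> J h w - S T h w / S T (\<lambda>_. 1) w\<bar> < \<epsilon> / 2"
        "\<bar>S T h w / S T (\<lambda>_. 1) w - smoothing \<chi>0 M G T h\<bar> < \<epsilon> / 2"
      by (auto simp: bad_def smoothing_def \<delta>(3) not_le)
    have "\<bar>a - b\<bar> < \<epsilon>" if "\<bar>a - s\<bar> < \<epsilon> / 2" "\<bar>s - b\<bar> < \<epsilon> / 2" for a b s :: real
      using that by linarith
    from this[OF d] w show False by simp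
  qed
  from prob_Un2_le[OF bad_sets[OF order.refl h] cd(1) this pB pD]
  have "prob {w \<in> space Pr. \<epsilon> \<le> \<bar>ffbsi_estimator N T \<xi> J h w - smoothing \<chi>0 M G T h\<bar>} \<le> (dev_factor T + 2) * ?e"
    by (simp add: algebra_simps)
  also have "min (dev_rate T) (1 / 2) * (real N * \<delta>\<^sup>2) = min (dev_rate T) (1 / 2) / 4 * real N * \<epsilon>\<^sup>2 / c\<^sup>2"
    by (simp add: \<delta>_def power_divide power_mult_distrib)
  finally show ?thesis .
qed

text \<open>The estimator and the smoothing distribution commute with adding constants, so one may assume \<open>\<bar>h\<bar> \<le> osc T h\<close>.\<close>

lemma ffbsi_deviation_osc:
  assumes sim: "backward_simulation_law J" and h: "h \<in> bounded_measurable T" and \<epsilon>: "0 < \<epsilon>"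
  shows "prob {w \<in> space Pr. \<epsilon> \<le> \<bar>ffbsi_estimator N T \<xi> J h w - smoothing \<chi>0 M G T h\<bar>}
    \<le> deviation_bound (dev_factor T + 2) (min (dev_rate T) (1 / 2) / 4) N \<epsilon> T h"
proof -
  let ?S = "space (pathspace T)"
  obtain K where K: "\<And>x. x \<in> ?S \<Longrightarrow> \<bar>h x\<bar> \<le> K"
    using bounded_measurableD(2)[OF h] by auto
  have osc: "\<bar>h x - h x'\<bar> \<le> osc T h" if "x \<in> ?S" "x' \<in> ?S" for x x'
  proof -
    have "bdd_above ((\<lambda>(x, x'). \<bar>h x - h x'\<bar>) ` (?S \<times> ?S))"
    proof (rule bdd_aboveI2)
      fix z assume "z \<in> ?S \<times> ?S"
      then show "(case z of (x, x') \<Rightarrow> \<bar>h x - h x'\<bar>) \<le> 2 * K"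
        using K[of "fst z"] K[of "snd z"] by (auto simp: case_prod_beta)
    qed
    from cSUP_upper[OF _ this, of "(x, x')"] that show ?thesis by (simp add: osc_def Let_def)
  qed
  define x0 :: "nat \<Rightarrow> 'x" where "x0 = (\<lambda>_\<in>{..T}. undefined)"
  have x0: "x0 \<in> ?S" by (simp add: x0_def space_PiM)
  have osc0: "0 \<le> osc T h" using osc[OF x0 x0] by simp
  \<comment> \<open>Written in the shape of \<open>\<gamma>_lincomb\<close>.\<close>
  let ?h = "\<lambda>x. 1 * h x + (- h x0) * 1"
  have h': "?h \<in> bounded_measurable T"
    by (rule bounded_measurable_lincomb[OF h bounded_measurable_const])
  have bd: "\<bar>?h x\<bar> \<le> osc T h" if "x \<in> ?S" for x using osc[OF that x0] by simp
  have est: "ffbsi_estimator N T \<xi> J ?h w = ffbsi_estimator N T \<xi> J h w - h x0" for w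
    using N_pos by (simp add: ffbsi_estimator_def sum_subtractf diff_divide_distrib)
  have smo: "smoothing \<chi>0 M G T ?h = smoothing \<chi>0 M G T h - h x0"
    unfolding smoothing_def \<gamma>_lincomb[OF h bounded_measurable_const order.refl]
    using \<gamma>_1_pos[of T] by (simp add: diff_divide_distrib)
  let ?A = "{w \<in> space Pr. \<epsilon> \<le> \<bar>ffbsi_estimator N T \<xi> J ?h w - smoothing \<chi>0 M G T ?h\<bar>}"
  have A: "{w \<in> space Pr. \<epsilon> \<le> \<bar>ffbsi_estimator N T \<xi> J h w - smoothing \<chi>0 M G T h\<bar>} = ?A"
    unfolding est smo by simp
  \<comment> \<open>True at every sample point, extinct or not: whatever the indices are, the
    estimator averages values of \<open>?h\<close> on the path space.\<close>
  have dev: "\<bar>ffbsi_estimator N T \<xi> J ?h w - smoothing \<chi>0 M G T ?h\<bar> \<le> 2 * osc T h" for w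
  proof -
    have "\<bar>\<Sum>l=1..N. ?h (\<lambda>t\<in>{..T}. \<xi> t (J l t w) w)\<bar> \<le> (\<Sum>l=1..N. osc T h)"
      by (intro order.trans[OF sum_abs] sum_mono bd) (simp add: space_PiM)
    then have "\<bar>ffbsi_estimator N T \<xi> J ?h w\<bar> \<le> osc T h"
      unfolding ffbsi_estimator_def using N_pos by (simp add: abs_divide divide_le_eq mult.commute)
    moreover have "\<bar>smoothing \<chi>0 M G T ?h\<bar> \<le> osc T h"
      unfolding smoothing_def using \<gamma>_abs_le[OF h' order.refl bd] \<gamma>_1_pos[of T]
      by (simp add: abs_divide divide_le_eq)
    ultimately show ?thesis by linarith
  qed
  show ?thesis
  \<comment> \<open>A tolerance above twice the oscillation is never reached, which also settles
    \<open>osc T h = 0\<close>, where the bound is 0. Otherwise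
    \<open>\<epsilon> \<le> 2 * osc T h\<close>, as \<open>ffbsi_deviation\<close> requires.\<close>
  proof (cases "2 * osc T h < \<epsilon>")
    case True
    then have empty: "?A = {}" using dev by (auto simp: not_le intro: le_less_trans)
    have "prob ?A = 0" unfolding empty by simp
    then show ?thesis unfolding A deviation_bound_def using dev_factor_pos[of T] by simp
  next
    case False
    then have "0 < osc T h" using \<epsilon> by simp
    then show ?thesis
      unfolding A deviation_bound_def using ffbsi_deviation[OF sim h' bd _ \<epsilon>] False by simp
  qed
qed

end

lemma SUP_sup_norm_finite:
  fixes f :: "'i \<Rightarrow> 'a \<Rightarrow> real"
  assumes "(SUP t\<in>A. sup_norm (f t)) < \<infinity>"
  shows "\<exists>K>0. \<forall>t\<in>A. \<forall>x. f t x \<le> K"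
proof -
  obtain r where r: "0 \<le> r" "(SUP t\<in>A. sup_norm (f t)) = ennreal r"
    using assms by (cases "SUP t\<in>A. sup_norm (f t)") auto
  have "f t x \<le> r" if "t \<in> A" for t x
  proof -
    have "ennreal \<bar>f t x\<bar> \<le> sup_norm (f t)" unfolding sup_norm_def by (rule SUP_upper) simp
    also have "\<dots> \<le> (SUP t\<in>A. sup_norm (f t))" using that by (rule SUP_upper)
    finally have "\<bar>f t x\<bar> \<le> r" unfolding r(2) using r(1) by simp
    then show ?thesis by simp
  qed
  \<comment> \<open>\<open>r\<close> itself may be 0, for instance when \<open>A\<close> is empty,
    as \<open>{1..T}\<close> is for \<open>T = 0\<close>.\<close>
  then show ?thesis using r(1) by (intro exI[of _ "r + 1"]) (auto intro: add_increasing2)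
qed

theorem corollary6:
  fixes \<chi>0 \<nu> \<rho>0 :: "'x::polish_space measure"
    and M :: "'x \<Rightarrow> 'x measure" and m :: "'x \<Rightarrow> 'x \<Rightarrow> real"
    and g :: "'x \<Rightarrow> 'y::polish_space \<Rightarrow> real" and y :: "nat \<Rightarrow> 'y" and T :: nat
    and r0 :: "'x \<Rightarrow> real" and \<theta> :: "nat \<Rightarrow> 'x \<Rightarrow> real"
    and P :: "nat \<Rightarrow> 'x \<Rightarrow> 'x measure" and p :: "nat \<Rightarrow> 'x \<Rightarrow> 'x \<Rightarrow> real"
  assumes model: "smc_model \<chi>0 \<nu> M m g y T \<rho>0 r0 \<theta> P p"
    and A1_pos: "\<forall>t\<le>T. \<forall>x. 0 < lik g y t x"
    and A1_bdd: "(SUP t\<in>{0..T}. sup_norm (lik g y t)) < \<infinity>"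
    and A2_adj: "(SUP t\<in>{1..T}. sup_norm (\<theta> t)) < \<infinity>"
    and A2_weight_init: "sup_norm (weight_init r0 (lik g y)) < \<infinity>"
    and A2_weight_step: "(SUP t\<in>{1..T}. sup_norm (\<lambda>(x, x'). weight_step m (lik g y) \<theta> p t x x')) < \<infinity>"
  shows "\<exists>B C. 0 < B \<and> 0 < C \<and>
    (\<forall>(N::nat) (Pr :: 'w measure) \<xi> I J.
      1 \<le> N \<longrightarrow>
      ffbsi Pr N T \<rho>0 \<theta> P (weight_init r0 (lik g y)) (weight_step m (lik g y) \<theta> p) \<xi> I m J \<longrightarrow>
      (\<forall>\<epsilon>>0. \<forall>h\<in>bounded_measurable T.
        measure Pr {w \<in> space Pr. \<epsilon> \<le> \<bar>ffbsi_estimator N T \<xi> J h w - smoothing \<chi>0 M (lik g y) T h\<bar>}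
          \<le> deviation_bound B C N \<epsilon> T h))"
proof -
  obtain Kg where Kg: "0 < Kg" "\<And>t x. t \<le> T \<Longrightarrow> lik g y t x \<le> Kg"
    using SUP_sup_norm_finite[OF A1_bdd] by auto
  obtain K\<theta> where K\<theta>: "0 < K\<theta>" "\<And>t x. t \<in> {1..T} \<Longrightarrow> \<theta> t x \<le> K\<theta>"
    using SUP_sup_norm_finite[OF A2_adj] by auto
  obtain K0 where K0: "0 < K0" "\<And>x. weight_init r0 (lik g y) x \<le> K0"
    \<comment> \<open>A one-point index set reduces a single function to the case of a
      family.\<close>
    using SUP_sup_norm_finite[where A="{()}" and f="\<lambda>_. weight_init r0 (lik g y)"] A2_weight_init by auto
  obtain K1 where K1: "0 < K1" "\<And>t x x'. t \<in> {1..T} \<Longrightarrow> weight_step m (lik g y) \<theta> p t x x' \<le> K1"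
    using SUP_sup_norm_finite[OF A2_weight_step] by auto
  interpret bounded_smc_model \<chi>0 \<nu> M m g y T \<rho>0 r0 \<theta> P p Kg K\<theta> "max K0 K1"
    by (intro bounded_smc_model.intro bounded_smc_model_axioms.intro model)
      (use Kg K\<theta> K0 K1 in \<open>auto intro: max.coboundedI1 max.coboundedI2\<close>)
  show ?thesis
  proof (intro exI conjI allI impI ballI)
    \<comment> \<open>Both constants are fixed by the model and its bounds, before \<open>N\<close>
      and the particle system are chosen.\<close>
    show "0 < dev_factor T + 2" using dev_factor_pos[of T] by simp
    show "0 < min (dev_rate T) (1 / 2) / 4" using dev_rate_pos[of T] by simp
  next
    fix N and Pr :: "'w measure" and \<xi> I J and \<epsilon> :: real and h :: "(nat \<Rightarrow> 'x) \<Rightarrow> real"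
    assume N: "1 \<le> N" and \<epsilon>: "0 < \<epsilon>" and h: "h \<in> bounded_measurable T"
      and ffbsi: "ffbsi Pr N T \<rho>0 \<theta> P (weight_init r0 (lik g y)) (weight_step m (lik g y) \<theta> p) \<xi> I m J"
    interpret ffbsi Pr N T \<rho>0 \<theta> P "weight_init r0 (lik g y)" "weight_step m (lik g y) \<theta> p" \<xi> I m J
      by (rule ffbsi)
    interpret run: smc_run \<chi>0 \<nu> M m g y T \<rho>0 r0 \<theta> P p Kg K\<theta> "max K0 K1" Pr N \<xi> I
      by unfold_locales (rule N)
    show "measure Pr {w \<in> space Pr. \<epsilon> \<le> \<bar>ffbsi_estimator N T \<xi> J h w - smoothing \<chi>0 M (lik g y) T h\<bar>}
        \<le> deviation_bound (dev_factor T + 2) (min (dev_rate T) (1 / 2) / 4) N \<epsilon> T h"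
      by (rule run.ffbsi_deviation_osc[OF backward_simulation h \<epsilon>])
  qed
qed

end
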